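(* Let $m\ge n$, $1\le k\le n$, $1<p<\infty$, and let $\Vert\cdot\Vert_{(k,p)}:\mathbb{DR}^{m\times n}\to\mathbb{DR}$ be the dual continuation of the Ky Fan $p$-$k$-norm on $\mathbb{R}^{m\times n}$. Let $\boldsymbol{A}=\boldsymbol{A}_{\rm s}+\boldsymbol{A}_{\rm i}\epsilon\in\mathbb{DR}^{m\times n}$. If $\boldsymbol{A}_{\rm s}=\boldsymbol{O}$, then $\Vert\boldsymbol{A}\Vert_{(k,p)}=\Vert\boldsymbol{A}_{\rm i}\Vert_{(k,p)}\,\epsilon$. If $\boldsymbol{A}_{\rm s}\neq\boldsymbol{O}$, let the singular values of $\boldsymbol{A}_{\rm s}$ satisfy $$\sigma_1\ge\cdots\ge\sigma_{k-t}>\sigma_{k-t+1}=\cdots=\sigma_k=\cdots=\sigma_{k+s}>\sigma_{k+s+1}\ge\cdots\ge\sigma_n,$$ let $\boldsymbol{A}_{\rm s}=\boldsymbol{U}\boldsymbol{\Sigma}\boldsymbol{V}^\top$ be a full SVD, and put $\boldsymbol{U}_1=\boldsymbol{U}(:,1:k-t)$, $\boldsymbol{U}_2=\boldsymbol{U}(:,k-t+1:k+s)$, $\boldsymbol{V}_1=\boldsymbol{V}(:,1:k-t)$, $\boldsymbol{V}_2=\boldsymbol{V}(:,k-t+1:k+s)$, $\boldsymbol{\Sigma}_1=\boldsymbol{\Sigma}(1:k-t,1:k-t)$, and $\boldsymbol{M}=\mathrm{sym}(\boldsymbol{U}_2^\top\boldsymbol{A}_{\rm i}\boldsymbol{V}_2)$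 with eigenvalues $\lambda_1(\boldsymbol{M})\ge\cdots\ge\lambda_{t+s}(\boldsymbol{M})$. Then $$\Vert\boldsymbol{A}\Vert_{(k,p)}=\Vert\boldsymbol{A}_{\rm s}\Vert_{(k,p)}+\frac{1}{\Vert\boldsymbol{A}_{\rm s}\Vert_{(k,p)}^{p-1}}\Big(\langle\boldsymbol{U}_1\boldsymbol{\Sigma}_1^{p-1}\boldsymbol{V}_1^\top,\boldsymbol{A}_{\rm i}\rangle+\sigma_k^{p-1}\sum_{\ell=1}^t\lambda_\ell(\boldsymbol{M})\Big)\epsilon.$$
   Context: Dual numbers: $\mathbb{DR}=\{p_{\rm s}+p_{\rm i}\epsilon: p_{\rm s},p_{\rm i}\in\mathbb{R}\}$ with $\epsilon\neq0$, $\epsilon^2=0$. Dual matrices are written $\boldsymbol{A}=\boldsymbol{A}_{\rm s}+\boldsymbol{A}_{\rm i}\epsilon$ with $\boldsymbol{A}_{\rm s},\boldsymbol{A}_{\rm i}$ real. Gâteaux derivative: $\mathcal{D}_u\phi(x)=\lim_{t\downarrow0}\frac{\phi(x+tu)-\phi(x)}{t}$. The dual continuation of a real-valued function $\phi$ on a real space $\mathcal{X}$ is $\tilde\phi(a+b\epsilon)=\phi(a)+\mathcal{D}_b\phi(a)\,\epsilon$ for $a,b\in\mathcal{X}$; the dual continuation of a norm is denoted by the same symbol. For $\boldsymbol{X}\in\mathbb{R}^{m\times n}$ with singular values $\sigma_1\ge\cdots\ge\sigma_n$, the Ky Fan $p$-$k$-norm is $\Vert\boldsymbol{X}\Vert_{(k,p)}=(\sum_{i=1}^k\sigma_i^p)^{1/p}$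 for $1\le p<\infty$. In the displayed chain of singular values, $t\ge1$ and $s\ge0$ are the integers such that $\{k-t+1,\dots,k+s\}$ is the set of all indices $j$ with $\sigma_j=\sigma_k$ (the parts of the chain before or after may be empty; terms with empty matrices are zero). A full SVD has $\boldsymbol{U}\in\mathbb{R}^{m\times m}$, $\boldsymbol{V}\in\mathbb{R}^{n\times n}$ orthogonal and $\boldsymbol{\Sigma}\in\mathbb{R}^{m\times n}$ diagonal with the singular values in nonincreasing order. $\boldsymbol{U}(:,a:b)$ denotes columns $a$ through $b$. $\mathrm{sym}(\boldsymbol{X})=\frac12(\boldsymbol{X}+\boldsymbol{X}^\top)$ and $\langle\boldsymbol{X},\boldsymbol{Y}\rangle=\mathrm{tr}(\boldsymbol{X}^\top\boldsymbol{Y})$. *)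

theory Defs
  imports
    Complex_Main
    "HOL-Library.Multiset"
    "Jordan_Normal_Form.Char_Poly"
    "Jordan_Normal_Form.DL_Submatrix"
begin

datatype dual_number = Dual (std_part: real) (inf_part: real)

instantiation dual_number :: "{comm_ring_1, real_algebra_1}"
begin

definition "0 = Dual 0 0"
definition "1 = Dual 1 0"
definition "x + y = Dual (std_part x + std_part y) (inf_part x + inf_part y)"
definition "- x = Dual (- std_part x) (- inf_part x)"
definition "x - y = Dual (std_part x - std_part y) (inf_part x - inf_part y)"
definition "x * y =
  Dual (std_part x * std_part y) (std_part x * inf_part y + inf_part x * std_part y)"
definition "scaleR c x = Dual (c * std_part x) (c * inf_part x)"

instance
  by standard
    (auto simp: zero_dual_number_def one_dual_number_def plus_dual_number_def
      uminus_dual_number_def minus_dual_number_def times_dual_number_def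
      scaleR_dual_number_def algebra_simps intro: dual_number.expand)

end

definition eps :: dual_number where
  "eps = Dual 0 1"

lemma eps_nonzero: "eps \<noteq> 0"
  by (simp add: eps_def zero_dual_number_def)

lemma eps_squared: "eps ^ 2 = 0"
  by (simp add: eps_def zero_dual_number_def times_dual_number_def power2_eq_square)

lemma dual_number_decomp:
  "x = of_real (std_part x) + of_real (inf_part x) * eps"
  by (cases x) (simp add: of_real_def eps_def one_dual_number_def plus_dual_number_def
      times_dual_number_def scaleR_dual_number_def)

definition std_mat :: "dual_number mat \<Rightarrow> real mat" where
  "std_mat A = map_mat std_part A"

definition inf_mat :: "dual_number mat \<Rightarrow> real mat" where
  "inf_mat A = map_mat inf_part A"

lemma dual_mat_decomp:
  "A = map_mat of_real (std_mat A) + eps \<cdot>\<^sub>m map_mat of_real (inf_mat A)"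
proof (rule eq_matI)
  fix i j
  assume "i < dim_row (map_mat of_real (std_mat A) + eps \<cdot>\<^sub>m map_mat of_real (inf_mat A))"
    "j < dim_col (map_mat of_real (std_mat A) + eps \<cdot>\<^sub>m map_mat of_real (inf_mat A))"
  then show "A $$ (i, j) =
      (map_mat of_real (std_mat A) + eps \<cdot>\<^sub>m map_mat of_real (inf_mat A)) $$ (i, j)"
    using dual_number_decomp[of "A $$ (i, j)"]
    by (simp add: std_mat_def inf_mat_def mult.commute)
qed (simp_all add: std_mat_def inf_mat_def)

definition has_gateaux_derivative ::
    "(real mat \<Rightarrow> real) \<Rightarrow> real mat \<Rightarrow> real mat \<Rightarrow> real \<Rightarrow> bool" where
  "has_gateaux_derivative \<phi> X D L \<longleftrightarrow>
     ((\<lambda>\<tau>. (\<phi> (X + \<tau> \<cdot>\<^sub>m D) - \<phi> X) / \<tau>) \<longlongrightarrow> L) (at_right 0)"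

(* unspecified when the one-sided limit does not exist *)
definition gateaux_derivative ::
    "(real mat \<Rightarrow> real) \<Rightarrow> real mat \<Rightarrow> real mat \<Rightarrow> real" where
  "gateaux_derivative \<phi> X D = (THE L. has_gateaux_derivative \<phi> X D L)"

definition dual_continuation ::
    "(real mat \<Rightarrow> real) \<Rightarrow> dual_number mat \<Rightarrow> dual_number" where
  "dual_continuation \<phi> A =
     of_real (\<phi> (std_mat A)) +
     of_real (gateaux_derivative \<phi> (std_mat A) (inf_mat A)) * eps"

(* The real eigenvalues in nonincreasing order, repeated by algebraic multiplicity; used
   for symmetric matrices only, where this list has one entry per row. *)
definition eigvals_desc :: "real mat \<Rightarrow> real list" where
  "eigvals_desc S = rev (sorted_list_of_multiset (proots (char_poly S)))"

(* The index of the eigenvalues and singular values starts at 1. *)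
definition eigval :: "real mat \<Rightarrow> nat \<Rightarrow> real" where
  "eigval S l = eigvals_desc S ! (l - 1)"

(* For an m x n matrix with m >= n there are n singular values, 1 <= j <= n. *)
definition singval :: "real mat \<Rightarrow> nat \<Rightarrow> real" where
  "singval X j = sqrt (eigval (X\<^sup>T * X) j)"

definition ky_fan_norm :: "nat \<Rightarrow> real \<Rightarrow> real mat \<Rightarrow> real" where
  "ky_fan_norm k p X = (\<Sum>i=1..k. singval X i powr p) powr (1 / p)"

definition orthogonal_matrix :: "nat \<Rightarrow> real mat \<Rightarrow> bool" where
  "orthogonal_matrix d Q \<longleftrightarrow>
     Q \<in> carrier_mat d d \<and> Q\<^sup>T * Q = 1\<^sub>m d \<and> Q * Q\<^sup>T = 1\<^sub>m d"

definition full_svd ::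
    "nat \<Rightarrow> nat \<Rightarrow> real mat \<Rightarrow> real mat \<Rightarrow> real mat \<Rightarrow> real mat \<Rightarrow> bool" where
  "full_svd m n X U S V \<longleftrightarrow>
     orthogonal_matrix m U \<and> orthogonal_matrix n V \<and>
     S = mat m n (\<lambda>(i, j). if i = j then singval X (i + 1) else 0) \<and>
     X = U * S * V\<^sup>T"

(* Columns a through b, counted from 1, whereas matrix entries are indexed from 0;
   there are no columns if b < a. *)
definition cols_from_to :: "real mat \<Rightarrow> nat \<Rightarrow> nat \<Rightarrow> real mat" where
  "cols_from_to X a b = submatrix X UNIV {a - 1..<b}"

definition leading_block :: "real mat \<Rightarrow> nat \<Rightarrow> real mat" where
  "leading_block X r = submatrix X {..<r} {..<r}"

(* real power of a diagonal matrix with nonnegative diagonal *)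
definition diag_powr :: "real mat \<Rightarrow> real \<Rightarrow> real mat" where
  "diag_powr D q =
     mat (dim_row D) (dim_col D) (\<lambda>(i, j). if i = j then D $$ (i, i) powr q else 0)"

definition sym_part :: "real mat \<Rightarrow> real mat" where
  "sym_part X = (1 / 2) \<cdot>\<^sub>m (X + X\<^sup>T)"

definition trace_mat :: "real mat \<Rightarrow> real" where
  "trace_mat X = (\<Sum>i<dim_row X. X $$ (i, i))"

definition inner_mat :: "real mat \<Rightarrow> real mat \<Rightarrow> real" where
  "inner_mat X Y = trace_mat (X\<^sup>T * Y)"

end

theory Submission
  imports Defs "Jordan_Normal_Form.Schur_Decomposition"
begin

text \<open>
  The singular values of \<open>X + \<tau> D\<close> are the square roots of the eigenvalues of its Gram matrix
  \<open>X\<^sup>T X + \<tau> (X\<^sup>T D + D\<^sup>T X) + \<tau>\<^sup>2 D\<^sup>T D\<close>, so everything reduces to one-sided derivatives of eigenvalues of a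
  symmetric matrix. Let \<open>l i = (\<sigma> i)\<^sup>2\<close> be the eigenvalues of \<open>X\<^sup>T X\<close> and let \<open>B = X\<^sup>T D + D\<^sup>T X\<close>.

  Choose an orthonormal eigenbasis of \<open>X\<^sup>T X\<close> in which \<open>B\<close> is moreover diagonal on every block of equal
  eigenvalues, with diagonal entries \<open>b i\<close> that are nonincreasing in each block
  (\<open>simultaneous_diagonalisation\<close>). A first-order rotation of this basis removes the remaining entries of \<open>B\<close>,
  and the min-max principle shows that the \<open>i\<close>-th eigenvalue of the perturbed Gram matrix is
  \<open>l i + \<tau> * b i + O(\<tau>\<^sup>2)\<close> (\<open>gram_eigval_perturbation\<close>). If \<open>\<sigma> i = 0\<close> then \<open>b i = 0\<close>, so the \<open>i\<close>-th singular
  value of \<open>X + \<tau> D\<close> is \<open>O(\<tau>)\<close> and its \<open>p\<close>-th power is \<open>o(\<tau>)\<close> because \<open>p > 1\<close>. With the chain rule, for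
  \<open>X \<noteq> 0\<close>, the norm has the derivative
  \<open>\<parallel>X\<parallel>\<close> to the power \<open>1 - p\<close> times the sum of \<open>(\<sigma> i) powr (p - 2) * b i / 2\<close> over the first \<open>k\<close> indices
  (\<open>ky_fan_gateaux_derivative\<close>), with zero terms where \<open>\<sigma> i = 0\<close>.

  A given singular value decomposition uses another eigenbasis, related to the first one by an orthogonal
  matrix that respects the blocks of equal singular values. Above the block of \<open>\<sigma> k\<close> all indices are counted,
  and the sum is a trace that does not depend on the basis (\<open>weighted_trace_basis_independent\<close>); it becomes
  the inner product of \<open>D\<close> with \<open>U1 * S1 powr (p - 1) * V1\<^sup>T\<close>. In the block of \<open>\<sigma> k\<close>, of which possibly only
  a part is counted, \<open>B\<close> is \<open>2 * \<sigma> k\<close> times the matrix \<open>M\<close>, so that the sorted numbers \<open>b i\<close> are \<open>2 * \<sigma> k\<close> times the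
  eigenvalues of \<open>M\<close> (\<open>block_eigvals\<close>). At \<open>X = 0\<close> the formula is positive homogeneity of the norm.
\<close>

section \<open>The spectral theorem for real symmetric matrices\<close>

text \<open>Over the complex numbers an eigenvalue exists because the characteristic polynomial splits. It is real
because the matrix equals its own adjoint, and a real root of the real characteristic polynomial has a real
eigenvector.\<close>

lemma real_symmetric_eigenvector:
  fixes S :: "real mat"
  assumes S: "S \<in> carrier_mat n n" and sym: "S\<^sup>T = S" and n: "n > 0"
  shows "\<exists>v e. eigenvector S v e"
proof -
  define C where "C = map_mat complex_of_real S"
  have C: "C \<in> carrier_mat n n" using S by (simp add: C_def)
  have CT: "C\<^sup>T = C" using S arg_cong[OF sym, of "map_mat complex_of_real"]
    by (simp add: C_def map_mat_transpose)
  obtain as where as: "char_poly C = (\<Prod>a\<leftarrow>as. [:- a, 1:])" "length as = n"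
    using char_poly_factorized[OF C] by blast
  then obtain a as' where as': "as = a # as'" using n by (cases as) auto
  have root: "poly (char_poly C) a = 0" using as(1) as' by simp
  then have "eigenvalue C a" using eigenvalue_root_char_poly[OF C] by simp
  then obtain z where z: "z \<in> carrier_vec n" "z \<noteq> 0\<^sub>v n" "C *\<^sub>v z = a \<cdot>\<^sub>v z"
    unfolding eigenvalue_def eigenvector_def using C by auto
  have conj: "conjugate (C *\<^sub>v z) = C *\<^sub>v conjugate z"
  proof (rule eq_vecI)
    fix i assume "i < dim_vec (C *\<^sub>v conjugate z)"
    then have i: "i < n" using C by simp
    have "dim_vec z = n" using z(1) by simp
    then show "conjugate (C *\<^sub>v z) $ i = (C *\<^sub>v conjugate z) $ i"
      using i S by (simp add: C_def scalar_prod_def)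
  qed (use C in simp)
  have "a * (z \<bullet>c z) = (C *\<^sub>v z) \<bullet> conjugate z"
    using z by simp
  also have "\<dots> = z \<bullet> (C *\<^sub>v conjugate z)"
    using transpose_vec_mult_scalar[OF C _ z(1), of "conjugate z"] z(1) CT by simp
  also have "\<dots> = z \<bullet>c (a \<cdot>\<^sub>v z)" using conj z(3) by simp
  also have "\<dots> = cnj a * (z \<bullet>c z)"
    using z(1) by (simp add: conjugate_smult_vec)
  finally have "a = cnj a" using z by simp
  then obtain r where r: "a = complex_of_real r"
    by (metis Reals_cases complex_is_Real_iff complex_cnj_cancel_iff Reals_cnj_iff)
  have "poly (map_poly complex_of_real (char_poly S)) (complex_of_real r) = 0"
    using root r unfolding C_def of_real_hom.char_poly_hom[OF S] by simp
  then have "poly (char_poly S) r = 0" by simp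
  then show ?thesis using eigenvalue_root_char_poly[OF S, of r] unfolding eigenvalue_def by blast
qed

lemma orthogonal_matrixI:
  assumes "Q \<in> carrier_mat d d" and "Q\<^sup>T * Q = 1\<^sub>m d"
  shows "orthogonal_matrix d Q"
  unfolding orthogonal_matrix_def
  using assms mat_mult_left_right_inverse[of "Q\<^sup>T" d Q] by simp

lemma orthogonal_matrixD:
  assumes "orthogonal_matrix d Q"
  shows "Q \<in> carrier_mat d d" "Q\<^sup>T * Q = 1\<^sub>m d" "Q * Q\<^sup>T = 1\<^sub>m d"
  using assms by (auto simp: orthogonal_matrix_def)

lemma orthogonal_matrix_transpose:
  "orthogonal_matrix d Q \<Longrightarrow> orthogonal_matrix d Q\<^sup>T"
  by (auto simp: orthogonal_matrix_def)

lemma orthogonal_matrix_mult: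
  assumes "orthogonal_matrix d P" and "orthogonal_matrix d Q"
  shows "orthogonal_matrix d (P * Q)"
proof (rule orthogonal_matrixI)
  note P = orthogonal_matrixD[OF assms(1)] and Q = orthogonal_matrixD[OF assms(2)]
  show "P * Q \<in> carrier_mat d d" using P Q by auto
  have "(P * Q)\<^sup>T * (P * Q) = Q\<^sup>T * (P\<^sup>T * P) * Q"
    using P(1) Q(1) by (simp add: transpose_mult assoc_mult_mat[of _ d d _ d _ d])
  then show "(P * Q)\<^sup>T * (P * Q) = 1\<^sub>m d" using P Q by simp
qed

lemma conjugate_real_vec [simp]: "conjugate (v :: real vec) = v"
  by (rule eq_vecI) auto

text \<open>Gram-Schmidt applied to a basis that starts with the given vector, followed by normalisation of the
columns.\<close>

lemma orthogonal_completion: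
  fixes v :: "real vec"
  assumes v: "v \<in> carrier_vec n" "v \<noteq> 0\<^sub>v n" and n: "n > 0"
  shows "\<exists>W c. orthogonal_matrix n W \<and> col W 0 = c \<cdot>\<^sub>v v"
proof -
  interpret vec_space "TYPE(real)" n .
  define bs where "bs = basis_completion v"
  note bc = basis_completion[OF v, folded bs_def]
  define ws where "ws = gram_schmidt n bs"
  note gs = cof_vec_space.gram_schmidt_result[OF bc(2,4,5) ws_def]
  have len: "length ws = n" using gs(4) bc(6) by simp
  have wsi: "ws ! i \<in> carrier_vec n" if "i < n" for i using gs(3) len that by auto
  have hd: "ws ! 0 = v"
  proof -
    obtain bs' where "bs = v # bs'" using bc(6,7) n by (cases bs) auto
    then have "hd ws = v" using cof_vec_space.gram_schmidt_hd[OF v(1)] by (simp add: ws_def)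
    then show ?thesis using len n by (metis hd_conv_nth length_0_conv less_irrefl)
  qed
  have orth: "ws ! i \<bullet> ws ! j = 0 \<longleftrightarrow> i \<noteq> j" if "i < n" "j < n" for i j
    using corthogonalD[OF gs(2), of i j] that len by simp
  define r where "r j = 1 / sqrt (ws ! j \<bullet> ws ! j)" for j
  define W where "W = mat n n (\<lambda>(i, j). r j * ws ! j $ i)"
  have W: "W \<in> carrier_mat n n" by (simp add: W_def)
  have col: "col W j = r j \<cdot>\<^sub>v ws ! j" if "j < n" for j
    using that wsi[OF that] by (intro eq_vecI) (auto simp: W_def)
  have "W\<^sup>T * W = 1\<^sub>m n"
  proof (rule eq_matI)
    fix i j assume "i < dim_row (1\<^sub>m n :: real mat)" "j < dim_col (1\<^sub>m n :: real mat)"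
    then have ij: "i < n" "j < n" by auto
    have "(W\<^sup>T * W) $$ (i, j) = r i * r j * (ws ! i \<bullet> ws ! j)"
      using ij W col wsi[OF ij(1)] wsi[OF ij(2)] by (simp add: smult_scalar_prod_distrib[of _ n] scalar_prod_smult_distrib[of _ n])
    also have "\<dots> = (if i = j then 1 else 0)"
    proof (cases "i = j")
      case True
      have "ws ! i \<bullet> ws ! i \<ge> 0" by (auto simp: scalar_prod_def intro!: sum_nonneg)
      moreover have "ws ! i \<bullet> ws ! i \<noteq> 0" using orth[of i i] ij by simp
      ultimately show ?thesis using True by (simp add: r_def)
    qed (use orth[OF ij] in simp)
    finally show "(W\<^sup>T * W) $$ (i, j) = 1\<^sub>m n $$ (i, j)" using ij by simp
  qed (use W in auto)
  then have "orthogonal_matrix n W" using W by (rule orthogonal_matrixI[rotated])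
  then show ?thesis using col[OF n] hd by metis
qed

lemma symmetric_congruence:
  fixes S :: "real mat"
  assumes "S \<in> carrier_mat n n" "S\<^sup>T = S" "P \<in> carrier_mat n k"
  shows "(P\<^sup>T * S * P)\<^sup>T = P\<^sup>T * S * P"
  using assms by (simp add: transpose_mult[of "P\<^sup>T" k n "S * P" k] transpose_mult[of S n n P k]
      assoc_mult_mat[of "P\<^sup>T" k n S n P k])

text \<open>Induction by deflation: rotating an eigenvector into the first coordinate turns the matrix into a scalar
block and a smaller block; symmetry makes the first row vanish together with the first column.\<close>

lemma symmetric_diagonalisation:
  fixes S :: "real mat"
  assumes "S \<in> carrier_mat n n" and "S\<^sup>T = S"
  shows "\<exists>P d. orthogonal_matrix n P \<and> P\<^sup>T * S * P = mat_diag n d"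
  using assms
proof (induction n arbitrary: S)
  case 0
  then have "orthogonal_matrix 0 (1\<^sub>m 0) \<and> (1\<^sub>m 0)\<^sup>T * S * 1\<^sub>m 0 = mat_diag 0 (\<lambda>i. 0)"
    by (auto simp: orthogonal_matrix_def mat_diag_def)
  then show ?case by blast
next
  case (Suc n S)
  let ?N = "Suc n"
  note S = Suc.prems
  obtain v e where "eigenvector S v e" using real_symmetric_eigenvector[OF S] by auto
  then have v: "v \<in> carrier_vec ?N" "v \<noteq> 0\<^sub>v ?N" "S *\<^sub>v v = e \<cdot>\<^sub>v v"
    using S by (auto simp: eigenvector_def)
  obtain W c where W: "orthogonal_matrix ?N W" and Wc: "col W 0 = c \<cdot>\<^sub>v v"
    using orthogonal_completion[OF v(1,2)] by auto
  note Wd = orthogonal_matrixD[OF W]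
  define T where "T = W\<^sup>T * S * W"
  have T: "T \<in> carrier_mat ?N ?N" using S Wd by (auto simp: T_def)
  have Tsym: "T\<^sup>T = T" unfolding T_def using symmetric_congruence[OF S Wd(1)] .
  have SW: "S *\<^sub>v col W 0 = e \<cdot>\<^sub>v col W 0"
    using S v by (simp add: Wc mult_mat_vec smult_smult_assoc mult.commute)
  have T0: "T $$ (i, 0) = (if i = 0 then e else 0)" if i: "i < ?N" for i
  proof -
    have "T $$ (i, 0) = (W\<^sup>T * (S * W)) $$ (i, 0)"
      using S Wd(1) by (simp add: T_def)
    also have "\<dots> = col W i \<bullet> (S *\<^sub>v col W 0)"
      using S Wd(1) i by (simp add: mult_mat_vec_def)
    also have "\<dots> = e * (W\<^sup>T * W) $$ (i, 0)"
      using SW Wd(1) i by simp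
    also have "\<dots> = (if i = 0 then e else 0)"
      using Wd(2) i by simp
    finally show ?thesis .
  qed
  have T0': "T $$ (0, i) = (if i = 0 then e else 0)" if i: "i < ?N" for i
    using T0[OF i] Tsym T i by (metis carrier_matD index_transpose_mat(1) zero_less_Suc)
  define S' where "S' = mat n n (\<lambda>(i, j). T $$ (Suc i, Suc j))"
  have S': "S' \<in> carrier_mat n n" by (simp add: S'_def)
  have S'sym: "S'\<^sup>T = S'"
  proof (rule eq_matI)
    fix i j assume "i < dim_row S'" "j < dim_col S'"
    then show "S'\<^sup>T $$ (i, j) = S' $$ (i, j)"
      using T arg_cong[OF Tsym, of "\<lambda>X. X $$ (Suc i, Suc j)"] by (simp add: S'_def)
  qed (use S' in auto)
  obtain P' d where P': "orthogonal_matrix n P'" and d: "P'\<^sup>T * S' * P' = mat_diag n d"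
    using Suc.IH[OF S' S'sym] by blast
  note P'd = orthogonal_matrixD[OF P']
  define Q where "Q = four_block_mat (1\<^sub>m 1) (0\<^sub>m 1 n) (0\<^sub>m n 1) P'"
  have QT: "Q\<^sup>T = four_block_mat (1\<^sub>m 1) (0\<^sub>m 1 n) (0\<^sub>m n 1) P'\<^sup>T"
    unfolding Q_def using P'd(1) by (subst transpose_four_block_mat) auto
  have Tb: "T = four_block_mat (e \<cdot>\<^sub>m 1\<^sub>m 1) (0\<^sub>m 1 n) (0\<^sub>m n 1) S'"
    using T S' T0 T0' by (intro eq_matI) (auto simp: S'_def)
  have one: "four_block_mat (1\<^sub>m 1) (0\<^sub>m 1 n) (0\<^sub>m n 1) (1\<^sub>m n) = (1\<^sub>m ?N :: real mat)"
    by (intro eq_matI) auto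
  have Qo: "orthogonal_matrix ?N Q"
  proof (rule orthogonal_matrixI)
    show "Q \<in> carrier_mat ?N ?N" using P'd(1) by (auto simp: Q_def)
    show "Q\<^sup>T * Q = 1\<^sub>m ?N" unfolding QT unfolding Q_def using P'd
      by (subst mult_four_block_mat[of _ 1 1 _ n _ n _ _ 1 _ n]) (auto simp: one)
  qed
  note Qd = orthogonal_matrixD[OF Qo]
  have "(W * Q)\<^sup>T * S * (W * Q) = Q\<^sup>T * T * Q"
    unfolding T_def using Wd(1) Qd(1) S(1)
    by (simp add: transpose_mult assoc_mult_mat[of _ ?N ?N _ ?N _ ?N])
  also have "\<dots> = four_block_mat (e \<cdot>\<^sub>m 1\<^sub>m 1) (0\<^sub>m 1 n) (0\<^sub>m n 1) (P'\<^sup>T * S' * P')"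
    unfolding QT Tb unfolding Q_def using P'd(1) S'
    by (subst mult_four_block_mat[of _ 1 1 _ n _ n _ _ 1 _ n], simp_all)+
  also have "\<dots> = mat_diag ?N (\<lambda>i. if i = 0 then e else d (i - 1))"
    unfolding d by (intro eq_matI) (auto simp: mat_diag_def)
  finally show ?case using orthogonal_matrix_mult[OF W Qo] by blast
qed


lemma proots_char_poly_diagonalised:
  assumes S: "S \<in> carrier_mat n n" and P: "orthogonal_matrix n P"
    and d: "P\<^sup>T * S * P = mat_diag n d"
  shows "proots (char_poly S) = mset (map d [0..<n])"
proof -
  note Pd = orthogonal_matrixD[OF P]
  have "similar_mat_wit (mat_diag n d) S P\<^sup>T P"
    using S Pd d by (intro similar_mat_witI[of _ _ n]) auto
  then have "char_poly (mat_diag n d) = char_poly S"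
    by (intro char_poly_similar) (auto simp: similar_mat_def)
  moreover have "char_poly (mat_diag n d) = (\<Prod>a\<leftarrow>diag_mat (mat_diag n d). [:- a, 1:])"
    by (rule char_poly_upper_triangular[of _ n]) (auto simp: upper_triangular_def mat_diag_def)
  moreover have "diag_mat (mat_diag n d) = map d [0..<n]"
    by (auto simp: diag_mat_def mat_diag_def)
  ultimately have cp: "char_poly S = (\<Prod>a\<leftarrow>map d [0..<n]. [:- a, 1:])" by simp
  have "proots (\<Prod>a\<leftarrow>xs. [:- a, 1:]) = mset xs" for xs :: "real list"
  proof (induction xs)
    case (Cons a xs)
    have "(\<Prod>a\<leftarrow>xs. [:- a, 1:]) \<noteq> (0 :: real poly)"
      by (auto simp: prod_list_zero_iff)
    then have "proots ([:- a, 1:] * (\<Prod>a\<leftarrow>xs. [:- a, 1:])) = {#a#} + mset xs"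
      using Cons by (subst proots_mult) auto
    then show ?case by simp
  qed simp
  then show ?thesis using cp by metis
qed

text \<open>This is how eigenvalue lists are computed below: any orthogonal diagonalisation with a nonincreasing
diagonal exhibits them.\<close>

lemma eigvals_desc_unique:
  assumes S: "S \<in> carrier_mat n n" and P: "orthogonal_matrix n P"
    and d: "P\<^sup>T * S * P = mat_diag n d"
    and anti: "\<And>i j. i \<le> j \<Longrightarrow> j < n \<Longrightarrow> d j \<le> d i"
  shows "eigvals_desc S = map d [0..<n]"
proof -
  have "sorted (rev (map d [0..<n]))"
    unfolding sorted_rev_iff_nth_mono using anti by simp
  moreover have "mset (rev (map d [0..<n])) = proots (char_poly S)"
    using proots_char_poly_diagonalised[OF S P d] by simp
  ultimately have "sorted_list_of_multiset (proots (char_poly S)) = rev (map d [0..<n])"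
    by (metis sorted_list_of_multiset_mset sorted_sort_id)
  then show ?thesis by (simp add: eigvals_desc_def)
qed

text \<open>Any orthogonal diagonalisation becomes sorted after a permutation of its columns.\<close>

lemma spectral_theorem:
  fixes S :: "real mat"
  assumes S: "S \<in> carrier_mat n n" and sym: "S\<^sup>T = S"
  shows "\<exists>P. orthogonal_matrix n P \<and> P\<^sup>T * S * P = mat_diag n (\<lambda>i. eigvals_desc S ! i)"
    and "length (eigvals_desc S) = n"
    and "\<And>i j. i \<le> j \<Longrightarrow> j < n \<Longrightarrow> eigvals_desc S ! j \<le> eigvals_desc S ! i"
proof -
  obtain P d where P: "orthogonal_matrix n P" and d: "P\<^sup>T * S * P = mat_diag n d"
    using symmetric_diagonalisation[OF S sym] by blast
  note Pd = orthogonal_matrixD[OF P]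
  have ms: "mset (eigvals_desc S) = mset (map d [0..<n])"
    using proots_char_poly_diagonalised[OF S P d] by (simp add: eigvals_desc_def)
  show len: "length (eigvals_desc S) = n" using mset_eq_length[OF ms] by simp
  have "sorted (rev (eigvals_desc S))" by (simp add: eigvals_desc_def)
  then show "\<And>i j. i \<le> j \<Longrightarrow> j < n \<Longrightarrow> eigvals_desc S ! j \<le> eigvals_desc S ! i"
    unfolding sorted_rev_iff_nth_mono len by simp
  obtain f where f: "f permutes {..<n}" and pl: "permute_list f (map d [0..<n]) = eigvals_desc S"
    using mset_eq_permutation[OF ms] by auto
  have fn: "f i < n" if "i < n" for i using permutes_in_image[OF f, of i] that by simp
  have finj: "f i = f j \<longleftrightarrow> i = j" for i j using permutes_inj[OF f] by (auto dest: injD)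
  have ev: "eigvals_desc S ! i = d (f i)" if "i < n" for i
    unfolding pl[symmetric] using that fn[OF that] f by (simp add: permute_list_nth)
  define R where "R = mat n n (\<lambda>(i, j). P $$ (i, f j))"
  have R: "R \<in> carrier_mat n n" by (simp add: R_def)
  have colR: "col R j = col P (f j)" if "j < n" for j
    using that Pd(1) fn[OF that] by (intro eq_vecI) (auto simp: R_def)
  have "R\<^sup>T * R = 1\<^sub>m n"
  proof (rule eq_matI)
    fix i j assume "i < dim_row (1\<^sub>m n :: real mat)" "j < dim_col (1\<^sub>m n :: real mat)"
    then have ij: "i < n" "j < n" by auto
    have "(R\<^sup>T * R) $$ (i, j) = (P\<^sup>T * P) $$ (f i, f j)"
      using ij R Pd(1) fn by (simp add: colR)
    then show "(R\<^sup>T * R) $$ (i, j) = 1\<^sub>m n $$ (i, j)"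
      using ij fn by (simp add: Pd(2) finj)
  qed (use R in auto)
  then have Ro: "orthogonal_matrix n R" using R by (rule orthogonal_matrixI[rotated])
  have "R\<^sup>T * S * R = mat_diag n (\<lambda>i. eigvals_desc S ! i)"
  proof (rule eq_matI)
    fix i j assume "i < dim_row (mat_diag n (\<lambda>i. eigvals_desc S ! i))"
      "j < dim_col (mat_diag n (\<lambda>i. eigvals_desc S ! i))"
    then have ij: "i < n" "j < n" by (auto simp: mat_diag_def)
    have "(R\<^sup>T * S * R) $$ (i, j) = (P\<^sup>T * S * P) $$ (f i, f j)"
      using ij R Pd(1) S fn by (simp add: colR)
    then show "(R\<^sup>T * S * R) $$ (i, j) = mat_diag n (\<lambda>i. eigvals_desc S ! i) $$ (i, j)"
      unfolding d using ij fn by (simp add: mat_diag_def finj ev)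
  qed (use R in \<open>auto simp: mat_diag_def\<close>)
  then show "\<exists>P. orthogonal_matrix n P \<and> P\<^sup>T * S * P = mat_diag n (\<lambda>i. eigvals_desc S ! i)"
    using Ro by blast
qed

section \<open>Simultaneous diagonalisation on eigenspaces\<close>

lemma index_mult_mat_sum:
  assumes "A \<in> carrier_mat k m" "B \<in> carrier_mat m l" "i < k" "j < l"
  shows "(A * B) $$ (i, j) = (\<Sum>a<m. A $$ (i, a) * B $$ (a, j))"
  using assms by (auto simp: scalar_prod_def atLeast0LessThan intro!: sum.cong)

lemma index_congruence:
  fixes X :: "real mat"
  assumes P: "P \<in> carrier_mat m k" and X: "X \<in> carrier_mat m n" and R: "R \<in> carrier_mat n l"
    and ij: "i < k" "j < l"
  shows "(P\<^sup>T * X * R) $$ (i, j) = (\<Sum>a<m. \<Sum>b<n. P $$ (a, i) * X $$ (a, b) * R $$ (b, j))"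
proof -
  have "(P\<^sup>T * X * R) $$ (i, j) = (\<Sum>b<n. (\<Sum>a<m. P $$ (a, i) * X $$ (a, b)) * R $$ (b, j))"
    using assms index_mult_mat_sum[of "P\<^sup>T" k m X n i]
    by (subst index_mult_mat_sum[of _ k n _ l]) (auto simp del: index_mult_mat intro!: sum.cong)
  also have "\<dots> = (\<Sum>b<n. \<Sum>a<m. P $$ (a, i) * X $$ (a, b) * R $$ (b, j))"
    by (simp add: sum_distrib_right)
  finally show ?thesis by (subst sum.swap)
qed

lemma orthogonal_matrix_cols_sum:
  assumes "orthogonal_matrix n Q" and "i < n" "j < n"
  shows "(\<Sum>a<n. Q $$ (a, i) * Q $$ (a, j)) = (if i = j then 1 else 0)"
proof -
  note Q = orthogonal_matrixD[OF assms(1)]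
  have "(\<Sum>a<n. Q $$ (a, i) * Q $$ (a, j)) = (Q\<^sup>T * Q) $$ (i, j)"
    using assms Q(1) by (subst index_mult_mat_sum[of _ n n _ n]) auto
  then show ?thesis using assms Q(2) by simp
qed

text \<open>The eigenbasis of \<open>H\<close> is free up to a rotation inside each eigenspace, and the rotation can be used to
diagonalise the compression of \<open>B\<close> to that eigenspace. Instead of treating the eigenspaces one by one, let
\<open>N\<close> be the block-diagonal part of \<open>B\<close> in an eigenbasis of \<open>H\<close> and diagonalise the single matrix \<open>c H + N\<close> for a
large \<open>c\<close>. The eigenvalues belonging to different eigenvalues of \<open>H\<close> are then so far apart that no
eigenvector can mix two eigenspaces, and the sorting of the eigenvalues of \<open>c H + N\<close> is the lexicographic
one: first by \<open>l\<close>, then by \<open>b\<close>.\<close>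

lemma simultaneous_diagonalisation:
  fixes H B :: "real mat"
  defines "l i \<equiv> eigvals_desc H ! i"
  assumes H: "H \<in> carrier_mat n n" "H\<^sup>T = H" and B: "B \<in> carrier_mat n n" "B\<^sup>T = B"
  shows "\<exists>V b. orthogonal_matrix n V \<and> V\<^sup>T * H * V = mat_diag n l \<and>
    (\<forall>i<n. \<forall>j<n. l i = l j \<longrightarrow> (V\<^sup>T * B * V) $$ (i, j) = (if i = j then b i else 0)) \<and>
    (\<forall>i j. i \<le> j \<and> j < n \<and> l i = l j \<longrightarrow> b j \<le> (b i :: real))"
proof -
  obtain P where P: "orthogonal_matrix n P" and PH: "P\<^sup>T * H * P = mat_diag n l"
    using spectral_theorem(1)[OF H] unfolding l_def by blast
  note Pd = orthogonal_matrixD[OF P]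
  define C where "C = P\<^sup>T * B * P"
  have C: "C \<in> carrier_mat n n" using Pd B by (simp add: C_def)
  have "C\<^sup>T = C" unfolding C_def using symmetric_congruence[OF B Pd(1)] .
  then have Csym: "C $$ (j, i) = C $$ (i, j)" if "i < n" "j < n" for i j
    using that C by (metis carrier_matD index_transpose_mat(1))
  define N where "N i j = (if l i = l j then C $$ (i, j) else 0)" for i j
  define K where "K = (\<Sum>i<n. \<Sum>j<n. \<bar>N i j\<bar>)"
  have K0: "K \<ge> 0" by (auto simp: K_def intro!: sum_nonneg)
  \<comment> \<open>Large enough that gaps between distinct \<open>c * l i\<close> exceed twice the size of \<open>N\<close>; terms with
      \<open>l i = l j\<close> contribute 0 because they are divided by 0.\<close>
  define c where "c = 1 + (\<Sum>i<n. \<Sum>j<n. 2 * K / \<bar>l i - l j\<bar>)"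
  have c: "c * \<bar>l i - l j\<bar> > 2 * K" if "i < n" "j < n" "l i \<noteq> l j" for i j
  proof -
    have "2 * K / \<bar>l i - l j\<bar> \<le> (\<Sum>j<n. 2 * K / \<bar>l i - l j\<bar>)"
      using that K0 by (intro member_le_sum) auto
    also have "\<dots> \<le> (\<Sum>i<n. \<Sum>j<n. 2 * K / \<bar>l i - l j\<bar>)"
      using that K0 by (intro member_le_sum[of i _ "\<lambda>i. \<Sum>j<n. 2 * K / \<bar>l i - l j\<bar>"]) (auto intro!: sum_nonneg)
    finally have "2 * K / \<bar>l i - l j\<bar> < c" by (simp add: c_def)
    then show ?thesis using that by (simp add: field_simps)
  qed
  define G where "G = mat n n (\<lambda>(i, j). (if i = j then c * l i else 0) + N i j)"
  have G: "G \<in> carrier_mat n n" by (simp add: G_def)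
  have Gsym: "G\<^sup>T = G"
    by (rule eq_matI) (auto simp: G_def N_def Csym)
  define g where "g i = eigvals_desc G ! i" for i
  obtain Q where Q: "orthogonal_matrix n Q" and QG: "Q\<^sup>T * G * Q = mat_diag n g"
    using spectral_theorem(1)[OF G Gsym] unfolding g_def by blast
  note Qd = orthogonal_matrixD[OF Q]
  have gmono: "g j \<le> g i" if "i \<le> j" "j < n" for i j
    using spectral_theorem(3)[OF G Gsym that] by (simp add: g_def)
  have ev: "(\<Sum>b<n. N a b * Q $$ (b, i)) = (g i - c * l a) * Q $$ (a, i)" if ai: "a < n" "i < n" for a i
  proof -
    have "G * Q = Q * (Q\<^sup>T * G * Q)"
      using Qd G by (simp add: assoc_mult_mat[of Q n n "Q\<^sup>T" n "G * Q" n, symmetric])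
    then have "(G * Q) $$ (a, i) = (Q * mat_diag n g) $$ (a, i)" by (simp add: QG)
    also have "\<dots> = g i * Q $$ (a, i)"
      using ai Qd(1) by (subst mat_diag_mult_right[of _ n]) auto
    finally have "g i * Q $$ (a, i) = (\<Sum>b<n. G $$ (a, b) * Q $$ (b, i))"
      using index_mult_mat_sum[OF G Qd(1) ai] by simp
    also have "\<dots> = (\<Sum>b<n. (if a = b then c * l a * Q $$ (b, i) else 0) + N a b * Q $$ (b, i))"
      using ai by (intro sum.cong) (auto simp: G_def algebra_simps)
    also have "\<dots> = c * l a * Q $$ (a, i) + (\<Sum>b<n. N a b * Q $$ (b, i))"
      using ai by (simp add: sum.distrib)
    finally show ?thesis by (simp add: algebra_simps)
  qed
  \<comment> \<open>Gershgorin's argument inside one eigenspace of \<open>H\<close>: look at the largest component of the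
      eigenvector among the indices \<open>b\<close> with \<open>l b = l a\<close>.\<close>
  have gersh: "\<bar>g i - c * l a\<bar> \<le> K" if ai: "a < n" "i < n" "Q $$ (a, i) \<noteq> 0" for a i
  proof -
    define A where "A = {a' \<in> {..<n}. l a' = l a}"
    have "finite A" "a \<in> A" using ai by (auto simp: A_def)
    have "Max ((\<lambda>b. \<bar>Q $$ (b, i)\<bar>) ` A) \<in> (\<lambda>b. \<bar>Q $$ (b, i)\<bar>) ` A"
      using \<open>finite A\<close> \<open>a \<in> A\<close> by (intro Max_in) auto
    then obtain a' where a'A: "a' \<in> A" and "Max ((\<lambda>b. \<bar>Q $$ (b, i)\<bar>) ` A) = \<bar>Q $$ (a', i)\<bar>" by auto
    then have a': "\<bar>Q $$ (b, i)\<bar> \<le> \<bar>Q $$ (a', i)\<bar>" if "b \<in> A" for b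
      using Max_ge[of "(\<lambda>b. \<bar>Q $$ (b, i)\<bar>) ` A" "\<bar>Q $$ (b, i)\<bar>"] \<open>finite A\<close> that by auto
    have a'n: "a' < n" "l a' = l a" using a'A by (auto simp: A_def)
    have pos: "\<bar>Q $$ (a', i)\<bar> > 0" using a'[OF \<open>a \<in> A\<close>] ai by simp
    have "\<bar>g i - c * l a\<bar> * \<bar>Q $$ (a', i)\<bar> = \<bar>\<Sum>b<n. N a' b * Q $$ (b, i)\<bar>"
      using ev[OF a'n(1) ai(2)] a'n(2) by (simp add: abs_mult)
    also have "\<dots> \<le> (\<Sum>b<n. \<bar>N a' b * Q $$ (b, i)\<bar>)" by (rule sum_abs)
    also have "\<dots> \<le> (\<Sum>b<n. \<bar>N a' b\<bar> * \<bar>Q $$ (a', i)\<bar>)"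
      using a' a'n(2) by (intro sum_mono) (auto simp: abs_mult N_def A_def intro!: mult_left_mono)
    also have "\<dots> = (\<Sum>b<n. \<bar>N a' b\<bar>) * \<bar>Q $$ (a', i)\<bar>" by (simp add: sum_distrib_right)
    also have "\<dots> \<le> K * \<bar>Q $$ (a', i)\<bar>"
      unfolding K_def using a'n(1)
      by (intro mult_right_mono member_le_sum[of a' _ "\<lambda>i. \<Sum>j<n. \<bar>N i j\<bar>"]) (auto intro!: sum_nonneg)
    finally show ?thesis using pos by simp
  qed
  have ex: "\<exists>a<n. Q $$ (a, i) \<noteq> 0" if "i < n" for i
  proof (rule ccontr)
    assume "\<not> ?thesis"
    then have "(\<Sum>a<n. Q $$ (a, i) * Q $$ (a, i)) = 0" by (intro sum.neutral) auto
    then show False using orthogonal_matrix_cols_sum[OF Q that that] by simp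
  qed
  \<comment> \<open>\<open>w i\<close> is an index in the support of column \<open>i\<close>, and \<open>m i\<close> the eigenvalue of \<open>H\<close> that it points to.\<close>
  define w where "w i = (SOME a. a < n \<and> Q $$ (a, i) \<noteq> 0)" for i
  have w: "w i < n" "Q $$ (w i, i) \<noteq> 0" if "i < n" for i
    using someI_ex[OF ex[OF that]] by (auto simp: w_def)
  define m where "m i = l (w i)" for i
  have supp: "l a = m i" if "a < n" "i < n" "Q $$ (a, i) \<noteq> 0" for a i
  proof (rule ccontr)
    assume "l a \<noteq> m i"
    then have "c * \<bar>l a - l (w i)\<bar> > 2 * K" using c[of a "w i"] that w by (simp add: m_def)
    moreover have "\<bar>g i - c * l a\<bar> \<le> K" "\<bar>g i - c * l (w i)\<bar> \<le> K"
      using gersh that w by auto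
    moreover have "c \<ge> 0" using K0 by (auto simp: c_def intro!: add_nonneg_nonneg sum_nonneg)
    then have "c * \<bar>l a - l (w i)\<bar> = \<bar>c * l a - c * l (w i)\<bar>"
      by (simp add: abs_mult flip: right_diff_distrib)
    ultimately show False by linarith
  qed
  have QL: "(\<Sum>a<n. l a * (Q $$ (a, i) * Q $$ (a, j))) = (if i = j then m i else 0)" if "i < n" "j < n" for i j
  proof -
    have "(\<Sum>a<n. l a * (Q $$ (a, i) * Q $$ (a, j))) = (\<Sum>a<n. m i * (Q $$ (a, i) * Q $$ (a, j)))"
      using supp that by (intro sum.cong) auto
    also have "\<dots> = m i * (\<Sum>a<n. Q $$ (a, i) * Q $$ (a, j))" by (simp add: sum_distrib_left)
    finally show ?thesis using orthogonal_matrix_cols_sum[OF Q that] by simp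
  qed
  have mmono: "m j \<le> m i" if ij: "i \<le> j" "j < n" for i j
  proof (rule ccontr)
    assume "\<not> ?thesis"
    then have less: "m i < m j" by simp
    then have "c * \<bar>l (w j) - l (w i)\<bar> > 2 * K" using c[of "w j" "w i"] ij w by (simp add: m_def)
    then have "c * m j - c * m i > 2 * K" using less by (simp add: m_def algebra_simps)
    moreover have "\<bar>g i - c * m i\<bar> \<le> K" "\<bar>g j - c * m j\<bar> \<le> K"
      using gersh[of "w i" i] gersh[of "w j" j] ij w by (auto simp: m_def)
    moreover have "g j \<le> g i" using gmono ij by simp
    ultimately show False by linarith
  qed
  define V where "V = P * Q"
  have V: "orthogonal_matrix n V" unfolding V_def by (rule orthogonal_matrix_mult[OF P Q])
  have VX: "V\<^sup>T * X * V = Q\<^sup>T * (P\<^sup>T * X * P) * Q" if "X \<in> carrier_mat n n" for X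
    unfolding V_def using Pd(1) Qd(1) that
    by (simp add: transpose_mult assoc_mult_mat[of _ n n _ n _ n])
  have "V\<^sup>T * H * V = mat_diag n m"
  proof (rule eq_matI)
    fix i j assume "i < dim_row (mat_diag n m)" "j < dim_col (mat_diag n m)"
    then have ij: "i < n" "j < n" by (auto simp: mat_diag_def)
    have "(V\<^sup>T * H * V) $$ (i, j) = (\<Sum>a<n. \<Sum>b<n. Q $$ (a, i) * mat_diag n l $$ (a, b) * Q $$ (b, j))"
      unfolding VX[OF H(1)] PH using Qd(1) ij by (subst index_congruence[of _ n n _ n _ n]) auto
    also have "\<dots> = (\<Sum>a<n. \<Sum>b<n. if a = b then l a * (Q $$ (a, i) * Q $$ (a, j)) else 0)"
      by (intro sum.cong) (auto simp: mat_diag_def)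
    also have "\<dots> = (\<Sum>a<n. l a * (Q $$ (a, i) * Q $$ (a, j)))" by simp
    finally show "(V\<^sup>T * H * V) $$ (i, j) = mat_diag n m $$ (i, j)"
      using QL ij by (simp add: mat_diag_def)
  qed (use orthogonal_matrixD[OF V] in \<open>auto simp: mat_diag_def\<close>)
  then have "eigvals_desc H = map m [0..<n]"
    by (intro eigvals_desc_unique[OF H(1) V] mmono)
  then have ml: "m i = l i" if "i < n" for i using that by (simp add: l_def)
  have VH: "V\<^sup>T * H * V = mat_diag n l"
    unfolding \<open>V\<^sup>T * H * V = mat_diag n m\<close> by (rule eq_matI) (auto simp: mat_diag_def ml)
  have VB: "(V\<^sup>T * B * V) $$ (i, j) = (if i = j then g i - c * l i else 0)"
    if ij: "i < n" "j < n" "l i = l j" for i j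
  proof -
    have "(V\<^sup>T * B * V) $$ (i, j) = (\<Sum>a<n. \<Sum>b<n. Q $$ (a, i) * C $$ (a, b) * Q $$ (b, j))"
      unfolding VX[OF B(1)] C_def[symmetric] using Qd(1) C ij
      by (subst index_congruence[of _ n n _ n _ n]) auto
    also have "\<dots> = (\<Sum>a<n. \<Sum>b<n. Q $$ (a, i) * N a b * Q $$ (b, j))"
    proof (intro sum.cong refl)
      fix a b assume "a \<in> {..<n}" "b \<in> {..<n}"
      then show "Q $$ (a, i) * C $$ (a, b) * Q $$ (b, j) = Q $$ (a, i) * N a b * Q $$ (b, j)"
        using supp[of a i] supp[of b j] ml[OF ij(1)] ml[OF ij(2)] ij
        by (cases "Q $$ (a, i) = 0"; cases "Q $$ (b, j) = 0") (auto simp: N_def)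
    qed
    also have "\<dots> = (\<Sum>a<n. Q $$ (a, i) * (\<Sum>b<n. N a b * Q $$ (b, j)))"
      by (simp add: sum_distrib_left mult.assoc)
    also have "\<dots> = (\<Sum>a<n. g j * (Q $$ (a, i) * Q $$ (a, j)) - c * (l a * (Q $$ (a, i) * Q $$ (a, j))))"
      using ij by (intro sum.cong) (auto simp: ev algebra_simps)
    also have "\<dots> = g j * (\<Sum>a<n. Q $$ (a, i) * Q $$ (a, j)) - c * (\<Sum>a<n. l a * (Q $$ (a, i) * Q $$ (a, j)))"
      by (simp add: sum_subtractf sum_distrib_left)
    finally show ?thesis
      using orthogonal_matrix_cols_sum[OF Q ij(1,2)] QL[OF ij(1,2)] ml ij by simp
  qed
  show ?thesis
    using V VH VB gmono by (intro exI[of _ V] exI[of _ "\<lambda>i. g i - c * l i"]) auto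
qed

section \<open>The min-max principle for Gram matrices\<close>

text \<open>Replacing the rows of \<open>A\<close> outside \<open>J\<close> by unit vectors on \<open>I\<close> and by zero elsewhere produces a singular
matrix, because row \<open>i\<close> is zero; a kernel vector satisfies all constraints. This replaces the count of
dimensions in the min-max principle.\<close>

lemma nontrivial_constrained_vector:
  fixes A :: "real mat"
  assumes A: "A \<in> carrier_mat n n" and i: "i < n" "i \<notin> I" "i \<notin> J" and IJ: "I \<inter> J = {}"
  shows "\<exists>x \<in> carrier_vec n. x \<noteq> 0\<^sub>v n \<and> (\<forall>j<n. j \<in> I \<longrightarrow> x $ j = 0) \<and>
    (\<forall>j<n. j \<in> J \<longrightarrow> (A *\<^sub>v x) $ j = 0)"
proof -
  define Z where "Z = mat_of_rows n (map (\<lambda>j. if j \<in> I then unit_vec n j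
    else if j \<in> J then row A j else 0\<^sub>v n) [0..<n])"
  have Z: "Z \<in> carrier_mat n n" by (intro carrier_matI) (auto simp: Z_def)
  have row: "row Z j = (if j \<in> I then unit_vec n j else if j \<in> J then row A j else 0\<^sub>v n)"
    if "j < n" for j using that A unfolding Z_def by (subst mat_of_rows_row) auto
  have "Z\<^sup>T *\<^sub>v unit_vec n i = 0\<^sub>v n"
  proof (rule eq_vecI)
    fix j assume "j < dim_vec (0\<^sub>v n :: real vec)"
    then have j: "j < n" by simp
    then have "(Z\<^sup>T *\<^sub>v unit_vec n i) $ j = row Z i $ j" using Z i by simp
    then show "(Z\<^sup>T *\<^sub>v unit_vec n i) $ j = 0\<^sub>v n $ j" using row[OF i(1)] i j by simp
  qed (use Z in auto)
  moreover have "unit_vec n i \<noteq> (0\<^sub>v n :: real vec)" by (rule unit_vec_nonzero[OF i(1)])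
  ultimately have "\<exists>v. v \<in> carrier_vec n \<and> v \<noteq> 0\<^sub>v n \<and> Z\<^sup>T *\<^sub>v v = 0\<^sub>v n"
    using unit_vec_carrier by blast
  then have "det Z\<^sup>T = 0" using Z det_0_iff_vec_prod_zero[of "Z\<^sup>T" n] by simp
  then have "det Z = 0" using det_transpose[OF Z] by simp
  then obtain x where x: "x \<in> carrier_vec n" "x \<noteq> 0\<^sub>v n" "Z *\<^sub>v x = 0\<^sub>v n"
    using det_0_iff_vec_prod_zero[OF Z] by auto
  have *: "row Z j \<bullet> x = 0" if "j < n" for j
    using arg_cong[OF x(3), of "\<lambda>v. v $ j"] that Z by simp
  have "x $ j = 0" if "j < n" "j \<in> I" for j
    using *[OF that(1)] row[OF that(1)] that x(1) by simp
  moreover have "(A *\<^sub>v x) $ j = 0" if "j < n" "j \<in> J" for j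
  proof -
    have "j \<notin> I" using IJ that by auto
    then show ?thesis using *[OF that(1)] row[OF that(1)] that A by simp
  qed
  ultimately show ?thesis using x by blast
qed

lemma scalar_prod_self_sum: "x \<in> carrier_vec n \<Longrightarrow> x \<bullet> x = (\<Sum>i<n. (x $ i)\<^sup>2)" for x :: "real vec"
  by (auto simp: scalar_prod_def atLeast0LessThan power2_eq_square)

lemma scalar_prod_self_nonneg: "x \<bullet> x \<ge> 0" for x :: "real vec"
  by (auto simp: scalar_prod_def intro!: sum_nonneg)

lemma scalar_prod_self_pos: "x \<in> carrier_vec n \<Longrightarrow> x \<noteq> 0\<^sub>v n \<Longrightarrow> x \<bullet> x > 0" for x :: "real vec"
  using conjugate_square_greater_0_vec[of x n] by simp

lemma scalar_prod_mult_mat_vec: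
  fixes E F :: "real mat"
  assumes "E \<in> carrier_mat m n" "F \<in> carrier_mat m k" "x \<in> carrier_vec n" "y \<in> carrier_vec k"
  shows "(E *\<^sub>v x) \<bullet> (F *\<^sub>v y) = x \<bullet> ((E\<^sup>T * F) *\<^sub>v y)"
proof -
  have "(E\<^sup>T * F) *\<^sub>v y = E\<^sup>T *\<^sub>v (F *\<^sub>v y)"
    using assms by (intro assoc_mult_mat_vec[of _ n m _ k]) auto
  then show ?thesis
    using transpose_vec_mult_scalar[of "E\<^sup>T" n m "F *\<^sub>v y" x] assms by simp
qed

lemma quadratic_form_mat_diag:
  fixes x :: "real vec"
  assumes "x \<in> carrier_vec n"
  shows "x \<bullet> (mat_diag n d *\<^sub>v x) = (\<Sum>i<n. d i * (x $ i)\<^sup>2)"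
proof -
  have "(mat_diag n d *\<^sub>v x) $ i = d i * x $ i" if "i < n" for i
  proof -
    have "(mat_diag n d *\<^sub>v x) $ i = (\<Sum>j<n. if i = j then d j * x $ j else 0)"
      using that assms by (auto simp: mat_diag_def scalar_prod_def atLeast0LessThan if_distrib[of "\<lambda>c. c * _"] cong: if_cong intro!: sum.cong)
    then show ?thesis using that by simp
  qed
  then show ?thesis using assms
    by (auto simp: scalar_prod_def atLeast0LessThan power2_eq_square mat_diag_def intro!: sum.cong)
qed

lemma orthogonal_matrix_isometry:
  assumes "orthogonal_matrix n P" and "x \<in> carrier_vec n"
  shows "(P *\<^sub>v x) \<bullet> (P *\<^sub>v x) = x \<bullet> x"
  using scalar_prod_mult_mat_vec[of P n n P n x x] orthogonal_matrixD[OF assms(1)] assms(2) by simp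

lemma gram_symmetric:
  fixes Y :: "real mat"
  assumes "Y \<in> carrier_mat m n"
  shows "Y\<^sup>T * Y \<in> carrier_mat n n" "(Y\<^sup>T * Y)\<^sup>T = Y\<^sup>T * Y"
  using assms by (auto simp: transpose_mult[of "Y\<^sup>T" n m Y n])

text \<open>The expansion of the Gram matrix of \<open>X + \<tau> D\<close> has first-order term \<open>X\<^sup>T D + D\<^sup>T X\<close>. In a basis \<open>V\<close> both
it and \<open>X\<^sup>T X\<close> are expressed through \<open>X V\<close> and \<open>D V\<close>.\<close>

lemma gram_congruence:
  fixes X V :: "real mat"
  assumes "X \<in> carrier_mat m n" and "V \<in> carrier_mat n n"
  shows "V\<^sup>T * (X\<^sup>T * X) * V = (X * V)\<^sup>T * (X * V)"
  using assms by (simp add: transpose_mult[of _ m n] assoc_mult_mat[of _ n n _ n _ n]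
      assoc_mult_mat[of _ n n _ m _ n] assoc_mult_mat[of _ n m _ n _ n])

lemma gram_first_order_symmetric:
  fixes X D :: "real mat"
  assumes "X \<in> carrier_mat m n" and "D \<in> carrier_mat m n"
  shows "X\<^sup>T * D + D\<^sup>T * X \<in> carrier_mat n n"
    and "(X\<^sup>T * D + D\<^sup>T * X)\<^sup>T = X\<^sup>T * D + D\<^sup>T * X"
  using assms
  by (simp_all add: transpose_add[of _ n n] transpose_mult[of _ n m _ n] comm_add_mat[of _ n n])

lemma gram_first_order_congruence:
  fixes X D V :: "real mat"
  assumes X: "X \<in> carrier_mat m n" and D: "D \<in> carrier_mat m n" and V: "V \<in> carrier_mat n n"
  shows "V\<^sup>T * (X\<^sup>T * D + D\<^sup>T * X) * V = (X * V)\<^sup>T * (D * V) + ((X * V)\<^sup>T * (D * V))\<^sup>T"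
proof -
  have "((X * V)\<^sup>T * (D * V))\<^sup>T = (D * V)\<^sup>T * (X * V)"
    using X D V by (simp add: transpose_mult[of "(X * V)\<^sup>T" n m "D * V" n])
  then show ?thesis using X D V
    by (simp add: mult_add_distrib_mat[of _ n n _ n] add_mult_distrib_mat[of _ n n _ _ n]
        transpose_mult[of _ m n _ n] assoc_mult_mat[of _ n n _ n _ n]
        assoc_mult_mat[of _ n n _ m _ n] assoc_mult_mat[of _ n m _ n _ n])
qed

lemma gram_spectral:
  fixes Y :: "real mat"
  assumes Y: "Y \<in> carrier_mat m n"
  obtains P where "orthogonal_matrix n P"
    and "\<And>y. y \<in> carrier_vec n \<Longrightarrow>
      (Y *\<^sub>v (P *\<^sub>v y)) \<bullet> (Y *\<^sub>v (P *\<^sub>v y)) = (\<Sum>i<n. eigvals_desc (Y\<^sup>T * Y) ! i * (y $ i)\<^sup>2)"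
proof -
  obtain P where P: "orthogonal_matrix n P"
      and PH: "P\<^sup>T * (Y\<^sup>T * Y) * P = mat_diag n (\<lambda>i. eigvals_desc (Y\<^sup>T * Y) ! i)"
    using spectral_theorem(1)[OF gram_symmetric[OF Y]] by blast
  note Pd = orthogonal_matrixD[OF P]
  show ?thesis
  proof (rule that[OF P])
    fix y :: "real vec" assume y: "y \<in> carrier_vec n"
    have "(Y * P)\<^sup>T * (Y * P) = P\<^sup>T * (Y\<^sup>T * Y) * P"
      by (rule gram_congruence[OF Y Pd(1), symmetric])
    moreover have "Y *\<^sub>v (P *\<^sub>v y) = (Y * P) *\<^sub>v y"
      using Y Pd(1) y by simp
    ultimately show "(Y *\<^sub>v (P *\<^sub>v y)) \<bullet> (Y *\<^sub>v (P *\<^sub>v y)) = (\<Sum>i<n. eigvals_desc (Y\<^sup>T * Y) ! i * (y $ i)\<^sup>2)"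
      using scalar_prod_mult_mat_vec[of "Y * P" m n "Y * P" n y y] Y Pd(1) y
        quadratic_form_mat_diag[OF y, of "\<lambda>i. eigvals_desc (Y\<^sup>T * Y) ! i"] by (simp add: PH)
  qed
qed

lemma gram_eigvals_nonneg:
  fixes Y :: "real mat"
  assumes Y: "Y \<in> carrier_mat m n" and i: "i < n"
  shows "eigvals_desc (Y\<^sup>T * Y) ! i \<ge> 0"
proof -
  obtain P where P: "\<And>y. y \<in> carrier_vec n \<Longrightarrow>
      (Y *\<^sub>v (P *\<^sub>v y)) \<bullet> (Y *\<^sub>v (P *\<^sub>v y)) = (\<Sum>i<n. eigvals_desc (Y\<^sup>T * Y) ! i * (y $ i)\<^sup>2)"
    using gram_spectral[OF Y] by blast
  have "(\<Sum>j<n. eigvals_desc (Y\<^sup>T * Y) ! j * (unit_vec n i $ j)\<^sup>2)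
      = (\<Sum>j<n. if j = i then eigvals_desc (Y\<^sup>T * Y) ! j else 0)"
    using i by (intro sum.cong) auto
  also have "\<dots> = eigvals_desc (Y\<^sup>T * Y) ! i" using i by simp
  finally show ?thesis
    using P[of "unit_vec n i"] scalar_prod_self_nonneg[of "Y *\<^sub>v (P *\<^sub>v unit_vec n i)"] by simp
qed

text \<open>One half of the min-max principle, in a form that tolerates an approximately orthonormal frame: the
vectors \<open>W x\<close> with \<open>x\<close> supported on the indices from \<open>i\<close> on meet the span of the first \<open>i + 1\<close> eigenvectors
nontrivially, and there the quadratic form is at least the \<open>i\<close>-th eigenvalue times the squared norm.\<close>

lemma gram_eigval_upper:
  fixes Y W :: "real mat"
  assumes Y: "Y \<in> carrier_mat m n" and W: "W \<in> carrier_mat n n" and i: "i < n"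
    and bound: "\<And>x. x \<in> carrier_vec n \<Longrightarrow> (\<And>j. j < i \<Longrightarrow> x $ j = 0) \<Longrightarrow>
      (Y *\<^sub>v (W *\<^sub>v x)) \<bullet> (Y *\<^sub>v (W *\<^sub>v x)) \<le> \<alpha> * (x \<bullet> x)"
    and expand: "\<And>x. x \<in> carrier_vec n \<Longrightarrow> x \<bullet> x \<le> (W *\<^sub>v x) \<bullet> (W *\<^sub>v x)"
  shows "eigvals_desc (Y\<^sup>T * Y) ! i \<le> \<alpha>"
proof -
  let ?e = "\<lambda>i. eigvals_desc (Y\<^sup>T * Y) ! i"
  obtain P where P: "orthogonal_matrix n P" and PY: "\<And>y. y \<in> carrier_vec n \<Longrightarrow>
      (Y *\<^sub>v (P *\<^sub>v y)) \<bullet> (Y *\<^sub>v (P *\<^sub>v y)) = (\<Sum>i<n. ?e i * (y $ i)\<^sup>2)"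
    using gram_spectral[OF Y] by blast
  note Pd = orthogonal_matrixD[OF P]
  obtain x where x: "x \<in> carrier_vec n" "x \<noteq> 0\<^sub>v n" "\<And>j. j < i \<Longrightarrow> x $ j = 0"
      "\<And>j. j < n \<Longrightarrow> i < j \<Longrightarrow> ((P\<^sup>T * W) *\<^sub>v x) $ j = 0"
  proof -
    have "P\<^sup>T * W \<in> carrier_mat n n" "{..<i} \<inter> {i<..} = {}" using Pd W by auto
    from nontrivial_constrained_vector[OF this(1) i _ _ this(2)] i show ?thesis
      by (auto intro: that simp del: index_mult_mat_vec assoc_mult_mat_vec)
  qed
  define y where "y = (P\<^sup>T * W) *\<^sub>v x"
  have y: "y \<in> carrier_vec n" using Pd W x by (simp add: y_def)
  have "P *\<^sub>v y = (P * (P\<^sup>T * W)) *\<^sub>v x"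
    unfolding y_def using Pd W x by (intro assoc_mult_mat_vec[symmetric]) auto
  also have "P * (P\<^sup>T * W) = W" using Pd W by (simp flip: assoc_mult_mat)
  finally have Py: "P *\<^sub>v y = W *\<^sub>v x" .
  have "?e i * (x \<bullet> x) \<le> ?e i * (y \<bullet> y)"
    using expand[OF x(1)] orthogonal_matrix_isometry[OF P y] gram_eigvals_nonneg[OF Y i]
    by (intro mult_left_mono) (auto simp: Py)
  also have "\<dots> = (\<Sum>j<n. ?e i * (y $ j)\<^sup>2)" using y by (simp add: scalar_prod_self_sum sum_distrib_left)
  also have "\<dots> \<le> (\<Sum>j<n. ?e j * (y $ j)\<^sup>2)"
  proof (intro sum_mono)
    fix j assume "j \<in> {..<n}"
    then show "?e i * (y $ j)\<^sup>2 \<le> ?e j * (y $ j)\<^sup>2"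
      using x(4)[of j] spectral_theorem(3)[OF gram_symmetric[OF Y], of j i] i
      by (cases "i < j") (auto simp: y_def[symmetric] intro!: mult_right_mono)
  qed
  also have "\<dots> \<le> \<alpha> * (x \<bullet> x)" using PY[OF y] bound[OF x(1,3)] Py by simp
  finally show ?thesis using scalar_prod_self_pos[OF x(1,2)] by simp
qed

text \<open>The other half: the supports and the eigenvectors are taken on the opposite sides of \<open>i\<close>, and the distortion
\<open>\<gamma>\<close> of the frame enters as a factor.\<close>

lemma gram_eigval_lower:
  fixes Y W :: "real mat"
  assumes Y: "Y \<in> carrier_mat m n" and W: "W \<in> carrier_mat n n" and i: "i < n"
    and bound: "\<And>x. x \<in> carrier_vec n \<Longrightarrow> (\<And>j. i < j \<Longrightarrow> j < n \<Longrightarrow> x $ j = 0) \<Longrightarrow>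
      \<alpha> * (x \<bullet> x) \<le> (Y *\<^sub>v (W *\<^sub>v x)) \<bullet> (Y *\<^sub>v (W *\<^sub>v x))"
    and expand: "\<And>x. x \<in> carrier_vec n \<Longrightarrow> (W *\<^sub>v x) \<bullet> (W *\<^sub>v x) \<le> \<gamma> * (x \<bullet> x)"
  shows "\<alpha> \<le> \<gamma> * eigvals_desc (Y\<^sup>T * Y) ! i"
proof -
  let ?e = "\<lambda>i. eigvals_desc (Y\<^sup>T * Y) ! i"
  obtain P where P: "orthogonal_matrix n P" and PY: "\<And>y. y \<in> carrier_vec n \<Longrightarrow>
      (Y *\<^sub>v (P *\<^sub>v y)) \<bullet> (Y *\<^sub>v (P *\<^sub>v y)) = (\<Sum>i<n. ?e i * (y $ i)\<^sup>2)"
    using gram_spectral[OF Y] by blast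
  note Pd = orthogonal_matrixD[OF P]
  obtain x where x: "x \<in> carrier_vec n" "x \<noteq> 0\<^sub>v n" "\<And>j. i < j \<Longrightarrow> j < n \<Longrightarrow> x $ j = 0"
      "\<And>j. j < i \<Longrightarrow> ((P\<^sup>T * W) *\<^sub>v x) $ j = 0"
  proof -
    have "P\<^sup>T * W \<in> carrier_mat n n" "{i<..} \<inter> {..<i} = {}" using Pd W by auto
    from nontrivial_constrained_vector[OF this(1) i _ _ this(2)] i show ?thesis
      by (auto intro: that simp del: index_mult_mat_vec assoc_mult_mat_vec)
  qed
  define y where "y = (P\<^sup>T * W) *\<^sub>v x"
  have y: "y \<in> carrier_vec n" using Pd W x by (simp add: y_def)
  have "P *\<^sub>v y = (P * (P\<^sup>T * W)) *\<^sub>v x"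
    unfolding y_def using Pd W x by (intro assoc_mult_mat_vec[symmetric]) auto
  also have "P * (P\<^sup>T * W) = W" using Pd W by (simp flip: assoc_mult_mat)
  finally have Py: "P *\<^sub>v y = W *\<^sub>v x" .
  have "\<alpha> * (x \<bullet> x) \<le> (\<Sum>j<n. ?e j * (y $ j)\<^sup>2)" using PY[OF y] bound[OF x(1,3)] Py by simp
  also have "\<dots> \<le> (\<Sum>j<n. ?e i * (y $ j)\<^sup>2)"
  proof (intro sum_mono)
    fix j assume "j \<in> {..<n}"
    then show "?e j * (y $ j)\<^sup>2 \<le> ?e i * (y $ j)\<^sup>2"
      using x(4)[of j] spectral_theorem(3)[OF gram_symmetric[OF Y], of i j] i
      by (cases "j < i") (auto simp: y_def[symmetric] intro!: mult_right_mono)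
  qed
  also have "\<dots> = ?e i * (y \<bullet> y)" using y by (simp add: scalar_prod_self_sum sum_distrib_left)
  also have "\<dots> \<le> ?e i * (\<gamma> * (x \<bullet> x))"
    using expand[OF x(1)] orthogonal_matrix_isometry[OF P y] gram_eigvals_nonneg[OF Y i]
    by (intro mult_left_mono) (auto simp: Py)
  finally have "\<alpha> * (x \<bullet> x) \<le> (\<gamma> * ?e i) * (x \<bullet> x)" by (simp add: algebra_simps)
  then show ?thesis using scalar_prod_self_pos[OF x(1,2)] by simp
qed

section \<open>Perturbation of Gram eigenvalues\<close>

lemma mat_vec_norm_bound:
  fixes E :: "real mat"
  assumes E: "E \<in> carrier_mat m n"
  shows "\<exists>c\<ge>0. \<forall>x \<in> carrier_vec n. (E *\<^sub>v x) \<bullet> (E *\<^sub>v x) \<le> c * (x \<bullet> x)"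
proof (intro exI conjI ballI)
  let ?c = "\<Sum>i<m. (\<Sum>j<n. \<bar>E $$ (i, j)\<bar>)\<^sup>2"
  show "?c \<ge> 0" by (intro sum_nonneg) auto
  fix x :: "real vec" assume x: "x \<in> carrier_vec n"
  have xj: "\<bar>x $ j\<bar> \<le> sqrt (x \<bullet> x)" if "j < n" for j
    using that member_le_sum[of j "{..<n}" "\<lambda>j. (x $ j)\<^sup>2"]
    by (simp add: scalar_prod_self_sum[OF x] real_le_rsqrt)
  have "((E *\<^sub>v x) $ i)\<^sup>2 \<le> (\<Sum>j<n. \<bar>E $$ (i, j)\<bar>)\<^sup>2 * (x \<bullet> x)" if "i < m" for i
  proof -
    have "(E *\<^sub>v x) $ i = (\<Sum>j<n. E $$ (i, j) * x $ j)"
      using that E x by (auto simp: scalar_prod_def atLeast0LessThan intro!: sum.cong)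
    also have "\<bar>\<dots>\<bar> \<le> (\<Sum>j<n. \<bar>E $$ (i, j)\<bar> * sqrt (x \<bullet> x))"
      by (rule order_trans[OF sum_abs sum_mono]) (auto simp: abs_mult xj intro!: mult_left_mono)
    finally have "\<bar>(E *\<^sub>v x) $ i\<bar> \<le> (\<Sum>j<n. \<bar>E $$ (i, j)\<bar>) * sqrt (x \<bullet> x)"
      by (simp add: sum_distrib_right)
    then have "((E *\<^sub>v x) $ i)\<^sup>2 \<le> ((\<Sum>j<n. \<bar>E $$ (i, j)\<bar>) * sqrt (x \<bullet> x))\<^sup>2"
      using power_mono[of "\<bar>(E *\<^sub>v x) $ i\<bar>" _ 2] by simp
    then show ?thesis by (simp add: power_mult_distrib scalar_prod_self_nonneg)
  qed
  then have "(\<Sum>i<m. ((E *\<^sub>v x) $ i)\<^sup>2) \<le> (\<Sum>i<m. (\<Sum>j<n. \<bar>E $$ (i, j)\<bar>)\<^sup>2 * (x \<bullet> x))"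
    by (intro sum_mono) auto
  then show "(E *\<^sub>v x) \<bullet> (E *\<^sub>v x) \<le> ?c * (x \<bullet> x)"
    using E x by (simp add: scalar_prod_self_sum[of _ m] sum_distrib_right)
qed

lemma smult_mat_mult_vec:
  fixes A :: "real mat"
  assumes "A \<in> carrier_mat m n" and "x \<in> carrier_vec n"
  shows "(c \<cdot>\<^sub>m A) *\<^sub>v x = c \<cdot>\<^sub>v (A *\<^sub>v x)"
  using assms by (intro eq_vecI) (auto simp: smult_scalar_prod_distrib[of _ n])

text \<open>The constant is generous; only uniformity in the vectors matters for the perturbation estimate.\<close>

lemma quadratic_expansion:
  fixes u v w :: "real vec"
  assumes u: "u \<in> carrier_vec m" and v: "v \<in> carrier_vec m" and w: "w \<in> carrier_vec m"
    and \<tau>: "0 < \<tau>" "\<tau> \<le> 1"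
  defines "z \<equiv> u + \<tau> \<cdot>\<^sub>v v + \<tau>\<^sup>2 \<cdot>\<^sub>v w"
  shows "\<bar>z \<bullet> z - (u \<bullet> u + 2 * \<tau> * (u \<bullet> v))\<bar> \<le> \<tau>\<^sup>2 * (3 * (u \<bullet> u + v \<bullet> v + w \<bullet> w))"
proof -
  have z: "z \<in> carrier_vec m" using u v w by (simp add: z_def)
  have pt: "\<bar>(a + \<tau> * b + \<tau>\<^sup>2 * c)\<^sup>2 - (a\<^sup>2 + 2 * \<tau> * (a * b))\<bar> \<le> \<tau>\<^sup>2 * (3 * (a\<^sup>2 + b\<^sup>2 + c\<^sup>2))" for a b c :: real
  proof -
    have id: "(a + \<tau> * b + \<tau>\<^sup>2 * c)\<^sup>2 - (a\<^sup>2 + 2 * \<tau> * (a * b)) = \<tau>\<^sup>2 * (b\<^sup>2 + 2 * (a * c) + 2 * (\<tau> * b * c) + (\<tau> * c)\<^sup>2)"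
      by (simp add: power2_eq_square algebra_simps)
    have ac: "2 * (a * c) \<le> a\<^sup>2 + c\<^sup>2" "- (2 * (a * c)) \<le> a\<^sup>2 + c\<^sup>2"
      using sum_squares_bound[of a c] sum_squares_bound[of "-a" c] by auto
    have bc: "2 * (\<tau> * b * c) \<le> b\<^sup>2 + (\<tau> * c)\<^sup>2" "- (2 * (\<tau> * b * c)) \<le> b\<^sup>2 + (\<tau> * c)\<^sup>2"
      using sum_squares_bound[of b "\<tau> * c"] sum_squares_bound[of "-b" "\<tau> * c"]
      by (auto simp: mult.assoc mult.left_commute)
    have "\<tau>\<^sup>2 \<le> 1" using \<tau> by (simp add: power_le_one)
    then have tc: "(\<tau> * c)\<^sup>2 \<le> c\<^sup>2" "(\<tau> * c)\<^sup>2 \<ge> 0"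
      by (auto simp: power_mult_distrib intro: mult_left_le_one_le)
    have sums: "\<bar>B + q + r + s\<bar> \<le> 3 * A + 3 * B + 3 * C"
      if "q \<le> A + C" "- q \<le> A + C" "r \<le> B + s" "- r \<le> B + s" "s \<le> C"
        "0 \<le> s" "0 \<le> A" "0 \<le> B" "0 \<le> C" for A B C q r s :: real
      using that by linarith
    have "\<bar>b\<^sup>2 + 2 * (a * c) + 2 * (\<tau> * b * c) + (\<tau> * c)\<^sup>2\<bar> \<le> 3 * (a\<^sup>2 + b\<^sup>2 + c\<^sup>2)"
      using sums[OF ac bc tc] by (simp add: distrib_left)
    then show ?thesis unfolding id by (simp add: abs_mult mult_left_mono)
  qed
  have "z \<bullet> z - (u \<bullet> u + 2 * \<tau> * (u \<bullet> v))
    = (\<Sum>i<m. (u $ i + \<tau> * v $ i + \<tau>\<^sup>2 * w $ i)\<^sup>2 - ((u $ i)\<^sup>2 + 2 * \<tau> * (u $ i * v $ i)))"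
  proof -
    have "u \<bullet> v = (\<Sum>i<m. u $ i * v $ i)"
      using u v by (simp add: scalar_prod_def atLeast0LessThan)
    moreover have "z \<bullet> z = (\<Sum>i<m. (u $ i + \<tau> * v $ i + \<tau>\<^sup>2 * w $ i)\<^sup>2)"
      unfolding scalar_prod_self_sum[OF z] using u v w by (intro sum.cong) (auto simp: z_def add.assoc)
    ultimately show ?thesis
      by (simp add: scalar_prod_self_sum[OF u] sum_subtractf sum.distrib sum_distrib_left)
  qed
  also have "\<bar>\<dots>\<bar> \<le> (\<Sum>i<m. \<tau>\<^sup>2 * (3 * ((u $ i)\<^sup>2 + (v $ i)\<^sup>2 + (w $ i)\<^sup>2)))"
    by (rule order_trans[OF sum_abs sum_mono]) (rule pt)
  also have "\<dots> = \<tau>\<^sup>2 * (3 * (u \<bullet> u + v \<bullet> v + w \<bullet> w))"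
    by (simp only: scalar_prod_self_sum[OF u] scalar_prod_self_sum[OF v] scalar_prod_self_sum[OF w]
        sum.distrib[symmetric] sum_distrib_left)
  finally show ?thesis .
qed

text \<open>Second-order accurate perturbation of the eigenvalues. The frame \<open>W = V (1 + \<tau> K)\<close> with antisymmetric \<open>K\<close> is
orthonormal up to \<open>\<tau>\<^sup>2\<close>, and \<open>K\<close> is chosen so that the off-diagonal first-order terms of the Gram matrix
cancel in it. What remains is the diagonal form with entries \<open>l i + \<tau> * b i\<close>, up to \<open>\<tau>\<^sup>2\<close>. For small
\<open>\<tau> > 0\<close> these entries are nonincreasing, since ties in \<open>l\<close> are broken by \<open>b\<close>, and the two halves of the
min-max principle apply. An error of order \<open>\<tau>\<^sup>2\<close>, rather than merely \<open>o(\<tau>)\<close>, is needed for the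
vanishing singular values.\<close>

lemma gram_eigval_perturbation:
  fixes X D V :: "real mat" and b :: "nat \<Rightarrow> real"
  defines "l i \<equiv> eigvals_desc (X\<^sup>T * X) ! i"
  assumes X: "X \<in> carrier_mat m n" and D: "D \<in> carrier_mat m n"
    and V: "orthogonal_matrix n V" and VH: "V\<^sup>T * (X\<^sup>T * X) * V = mat_diag n l"
    and VB: "\<And>i j. i < n \<Longrightarrow> j < n \<Longrightarrow> l i = l j \<Longrightarrow>
      (V\<^sup>T * (X\<^sup>T * D + D\<^sup>T * X) * V) $$ (i, j) = (if i = j then b i else 0)"
    and banti: "\<And>i j. i \<le> j \<Longrightarrow> j < n \<Longrightarrow> l i = l j \<Longrightarrow> b j \<le> b i"
  shows "\<exists>C. \<forall>\<^sub>F \<tau> in at_right 0. \<forall>i<n.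
    \<bar>eigvals_desc ((X + \<tau> \<cdot>\<^sub>m D)\<^sup>T * (X + \<tau> \<cdot>\<^sub>m D)) ! i - (l i + \<tau> * b i)\<bar> \<le> C * \<tau>\<^sup>2"
proof -
  note Vd = orthogonal_matrixD[OF V]
  have lanti: "l j \<le> l i" if "i \<le> j" "j < n" for i j
    using spectral_theorem(3)[OF gram_symmetric[OF X] that] by (simp add: l_def)
  define B where "B = V\<^sup>T * (X\<^sup>T * D + D\<^sup>T * X) * V"
  note XD = gram_first_order_symmetric[OF X D]
  have B: "B \<in> carrier_mat n n" using XD(1) Vd by (simp add: B_def)
  have "B\<^sup>T = B" unfolding B_def by (rule symmetric_congruence[OF XD Vd(1)])
  then have Bsym: "B $$ (j, i) = B $$ (i, j)" if "i < n" "j < n" for i j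
    using that B by (metis carrier_matD index_transpose_mat(1))
  \<comment> \<open>The solution of \<open>(l i - l j) * K i j + B i j = 0\<close> off the blocks of equal eigenvalues.\<close>
  define K where "K = mat n n (\<lambda>(i, j). if l i = l j then 0 else - B $$ (i, j) / (l i - l j))"
  have K: "K \<in> carrier_mat n n" by (simp add: K_def)
  have Kanti: "K $$ (j, i) = - K $$ (i, j)" if "i < n" "j < n" for i j
    using that Bsym[OF that] by (simp add: K_def divide_simps) (simp add: algebra_simps)
  have KT: "K\<^sup>T = - K" 
  proof (rule eq_matI)
    fix i j assume "i < dim_row (- K)" "j < dim_col (- K)"
    then show "K\<^sup>T $$ (i, j) = (- K) $$ (i, j)" using K Kanti[of i j] by simp
  qed (use K in auto)
  \<comment> \<open>The coefficients of \<open>(X + \<tau> D) W\<close> as a polynomial in \<open>\<tau>\<close>.\<close>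
  define E0 where "E0 = X * V"
  define E1 where "E1 = X * V * K + D * V"
  define E2 where "E2 = D * V * K"
  have E: "E0 \<in> carrier_mat m n" "E1 \<in> carrier_mat m n" "E2 \<in> carrier_mat m n"
    using X D Vd K by (auto simp: E0_def E1_def E2_def)
  have E00: "E0\<^sup>T * E0 = mat_diag n l"
    unfolding VH[symmetric] E0_def by (rule gram_congruence[OF X Vd(1), symmetric])
  have first_order: "x \<bullet> ((E0\<^sup>T * E1) *\<^sub>v x) + x \<bullet> ((E1\<^sup>T * E0) *\<^sub>v x) = (\<Sum>i<n. b i * (x $ i)\<^sup>2)"
    if x: "x \<in> carrier_vec n" for x
  proof -
    define F where "F = E0\<^sup>T * (D * V)"
    have F: "F \<in> carrier_mat n n" using E D Vd by (simp add: F_def)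
    have E01: "E0\<^sup>T * E1 = mat_diag n l * K + F"
    proof -
      have "E1 = E0 * K + D * V" by (simp add: E1_def E0_def)
      then have "E0\<^sup>T * E1 = E0\<^sup>T * (E0 * K) + F"
        unfolding F_def using E D Vd K by (simp add: mult_add_distrib_mat[of _ n m _ n])
      also have "E0\<^sup>T * (E0 * K) = mat_diag n l * K"
        unfolding E00[symmetric] using E K by (simp add: assoc_mult_mat[of _ n m _ n _ n])
      finally show ?thesis .
    qed
    have E10: "E1\<^sup>T * E0 = (E0\<^sup>T * E1)\<^sup>T"
      using E by (simp add: transpose_mult[of _ n m _ n])
    have BF: "B = F + F\<^sup>T"
      unfolding B_def F_def E0_def by (rule gram_first_order_congruence[OF X D Vd(1)])
    have "E0\<^sup>T * E1 + E1\<^sup>T * E0 = mat_diag n b"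
    proof (rule eq_matI)
      fix i j assume "i < dim_row (mat_diag n b)" "j < dim_col (mat_diag n b)"
      then have ij: "i < n" "j < n" by (auto simp: mat_diag_def)
      define G where "G = mat_diag n l * K + F"
      have G: "G \<in> carrier_mat n n" using K F by (simp add: G_def)
      have e: "G $$ (i, j) = l i * K $$ (i, j) + F $$ (i, j)"
        if "i < n" "j < n" for i j
        using that K F by (simp add: G_def mat_diag_mult_left[of _ n n])
      have "(E0\<^sup>T * E1 + E1\<^sup>T * E0) $$ (i, j) = l i * K $$ (i, j) + F $$ (i, j) + (l j * K $$ (j, i) + F $$ (j, i))"
        unfolding E10 E01 G_def[symmetric] using ij G e[OF ij] e[OF ij(2) ij(1)] by simp
      also have "\<dots> = (l i - l j) * K $$ (i, j) + B $$ (i, j)"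
        unfolding Kanti[OF ij] BF using F ij by (simp add: algebra_simps)
      also have "\<dots> = (if l i = l j then B $$ (i, j) else 0)"
        using ij by (simp add: K_def)
      also have "\<dots> = mat_diag n b $$ (i, j)"
        using VB[OF ij] ij by (auto simp: mat_diag_def B_def[symmetric])
      finally show "(E0\<^sup>T * E1 + E1\<^sup>T * E0) $$ (i, j) = mat_diag n b $$ (i, j)" .
    qed (use E in \<open>auto simp: mat_diag_def\<close>)
    moreover have "x \<bullet> ((E0\<^sup>T * E1 + E1\<^sup>T * E0) *\<^sub>v x) = x \<bullet> ((E0\<^sup>T * E1) *\<^sub>v x) + x \<bullet> ((E1\<^sup>T * E0) *\<^sub>v x)"
    proof -
      have car: "E0\<^sup>T * E1 \<in> carrier_mat n n" "E1\<^sup>T * E0 \<in> carrier_mat n n" using E by auto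
      then have "(E0\<^sup>T * E1) *\<^sub>v x \<in> carrier_vec n" "(E1\<^sup>T * E0) *\<^sub>v x \<in> carrier_vec n"
        using x mult_mat_vec_carrier by blast+
      then show ?thesis
        unfolding add_mult_distrib_mat_vec[OF car x] by (rule scalar_prod_add_distrib[OF x])
    qed
    ultimately show ?thesis using quadratic_form_mat_diag[OF x, of b] by simp
  qed
  obtain c0 where c0: "c0 \<ge> 0" "\<And>x. x \<in> carrier_vec n \<Longrightarrow> (E0 *\<^sub>v x) \<bullet> (E0 *\<^sub>v x) \<le> c0 * (x \<bullet> x)"
    using mat_vec_norm_bound[OF E(1)] by blast
  obtain c1 where c1: "c1 \<ge> 0" "\<And>x. x \<in> carrier_vec n \<Longrightarrow> (E1 *\<^sub>v x) \<bullet> (E1 *\<^sub>v x) \<le> c1 * (x \<bullet> x)"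
    using mat_vec_norm_bound[OF E(2)] by blast
  obtain c2 where c2: "c2 \<ge> 0" "\<And>x. x \<in> carrier_vec n \<Longrightarrow> (E2 *\<^sub>v x) \<bullet> (E2 *\<^sub>v x) \<le> c2 * (x \<bullet> x)"
    using mat_vec_norm_bound[OF E(3)] by blast
  obtain k where k: "k \<ge> 0" "\<And>x. x \<in> carrier_vec n \<Longrightarrow> (K *\<^sub>v x) \<bullet> (K *\<^sub>v x) \<le> k * (x \<bullet> x)"
    using mat_vec_norm_bound[OF K] by blast
  define C where "C = 3 * (c0 + c1 + c2)"
  have C0: "C \<ge> 0" using c0 c1 c2 by (simp add: C_def)
  \<comment> \<open>An upper bound for all perturbed eigenvalues; it absorbs the factor by which \<open>W\<close> expands norms.\<close>
  define L where "L = (\<Sum>i<n. \<bar>l i\<bar>) + (\<Sum>i<n. \<bar>b i\<bar>) + C"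
  define W where "W \<tau> = V + \<tau> \<cdot>\<^sub>m (V * K)" for \<tau>
  have W: "W \<tau> \<in> carrier_mat n n" for \<tau> using Vd K by (simp add: W_def)
  have Wx: "W \<tau> *\<^sub>v x = V *\<^sub>v x + \<tau> \<cdot>\<^sub>v (V *\<^sub>v (K *\<^sub>v x))" if x: "x \<in> carrier_vec n" for \<tau> x
    unfolding W_def using Vd K x
    by (simp add: add_mult_distrib_mat_vec[of _ n n] smult_mat_mult_vec[of _ n n])
  have YW: "(X + \<tau> \<cdot>\<^sub>m D) *\<^sub>v (W \<tau> *\<^sub>v x) = E0 *\<^sub>v x + \<tau> \<cdot>\<^sub>v (E1 *\<^sub>v x) + \<tau>\<^sup>2 \<cdot>\<^sub>v (E2 *\<^sub>v x)"
    if x: "x \<in> carrier_vec n" for \<tau> x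
  proof -
    have car: "V *\<^sub>v x \<in> carrier_vec n" "V *\<^sub>v (K *\<^sub>v x) \<in> carrier_vec n" using Vd K x by auto
    have regroup: "(a + \<tau> \<cdot>\<^sub>v c) + \<tau> \<cdot>\<^sub>v (b + \<tau> \<cdot>\<^sub>v d) = a + \<tau> \<cdot>\<^sub>v (b + c) + \<tau>\<^sup>2 \<cdot>\<^sub>v d"
      if "a \<in> carrier_vec m" "b \<in> carrier_vec m" "c \<in> carrier_vec m" "d \<in> carrier_vec m" for a b c d :: "real vec"
      using that by (intro eq_vecI) (auto simp: distrib_left power2_eq_square)
    have "(X + \<tau> \<cdot>\<^sub>m D) *\<^sub>v (W \<tau> *\<^sub>v x) = (X *\<^sub>v (V *\<^sub>v x) + \<tau> \<cdot>\<^sub>v (D *\<^sub>v (V *\<^sub>v x)))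
      + \<tau> \<cdot>\<^sub>v (X *\<^sub>v (V *\<^sub>v (K *\<^sub>v x)) + \<tau> \<cdot>\<^sub>v (D *\<^sub>v (V *\<^sub>v (K *\<^sub>v x))))"
      unfolding Wx[OF x] using car X D
      by (simp add: add_mult_distrib_mat_vec[of _ m n] mult_add_distrib_mat_vec[of _ m n] mult_mat_vec[of _ m n]
          smult_mat_mult_vec[of _ m n])
    also have "\<dots> = X *\<^sub>v (V *\<^sub>v x) + \<tau> \<cdot>\<^sub>v (X *\<^sub>v (V *\<^sub>v (K *\<^sub>v x)) + D *\<^sub>v (V *\<^sub>v x)) + \<tau>\<^sup>2 \<cdot>\<^sub>v (D *\<^sub>v (V *\<^sub>v (K *\<^sub>v x)))"
      using X D by (intro regroup mult_mat_vec_carrier[of _ m n] car) auto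
    also have "\<dots> = E0 *\<^sub>v x + \<tau> \<cdot>\<^sub>v (E1 *\<^sub>v x) + \<tau>\<^sup>2 \<cdot>\<^sub>v (E2 *\<^sub>v x)"
      using X D Vd(1) K x by (simp add: E0_def E1_def E2_def add_mult_distrib_mat_vec[of _ m n]
          assoc_mult_mat_vec[of _ m n _ n] assoc_mult_mat[of _ m n _ n _ n])
    finally show ?thesis .
  qed
  have Wnorm: "(W \<tau> *\<^sub>v x) \<bullet> (W \<tau> *\<^sub>v x) = x \<bullet> x + \<tau>\<^sup>2 * ((K *\<^sub>v x) \<bullet> (K *\<^sub>v x))"
    if x: "x \<in> carrier_vec n" for \<tau> x
  proof -
    have Kx: "K *\<^sub>v x \<in> carrier_vec n" using K x by simp
    have "- (x \<bullet> (K *\<^sub>v x)) = - ((K *\<^sub>v x) \<bullet> x)" using comm_scalar_prod[OF x Kx] by simp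
    also have "\<dots> = (K\<^sup>T *\<^sub>v x) \<bullet> x" unfolding KT using K x by simp
    also have "\<dots> = x \<bullet> (K *\<^sub>v x)" by (rule transpose_vec_mult_scalar[OF K x x])
    finally have zero: "x \<bullet> (K *\<^sub>v x) = 0" by simp
    have zero': "(K *\<^sub>v x) \<bullet> x = 0" using zero comm_scalar_prod[OF x Kx] by simp
    have "W \<tau> *\<^sub>v x = V *\<^sub>v (x + \<tau> \<cdot>\<^sub>v (K *\<^sub>v x))"
      unfolding Wx[OF x] using Vd(1) Kx x
      by (simp add: mult_add_distrib_mat_vec[of _ n n] mult_mat_vec[of _ n n])
    then have "(W \<tau> *\<^sub>v x) \<bullet> (W \<tau> *\<^sub>v x) = (x + \<tau> \<cdot>\<^sub>v (K *\<^sub>v x)) \<bullet> (x + \<tau> \<cdot>\<^sub>v (K *\<^sub>v x))"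
      using orthogonal_matrix_isometry[OF V, of "x + \<tau> \<cdot>\<^sub>v (K *\<^sub>v x)"] x Kx by simp
    also have "\<dots> = x \<bullet> x + \<tau>\<^sup>2 * ((K *\<^sub>v x) \<bullet> (K *\<^sub>v x))"
      using x Kx zero zero' by (simp add: scalar_prod_add_distrib[of _ n] add_scalar_prod_distrib[of _ n]
          smult_scalar_prod_distrib[of _ n] scalar_prod_smult_distrib[of _ n] power2_eq_square)
    finally show ?thesis .
  qed
  have quad: "\<bar>((X + \<tau> \<cdot>\<^sub>m D) *\<^sub>v (W \<tau> *\<^sub>v x)) \<bullet> ((X + \<tau> \<cdot>\<^sub>m D) *\<^sub>v (W \<tau> *\<^sub>v x))
      - (\<Sum>i<n. (l i + \<tau> * b i) * (x $ i)\<^sup>2)\<bar> \<le> C * \<tau>\<^sup>2 * (x \<bullet> x)"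
    if x: "x \<in> carrier_vec n" and \<tau>: "0 < \<tau>" "\<tau> \<le> 1" for \<tau> x
  proof -
    have car: "E0 *\<^sub>v x \<in> carrier_vec m" "E1 *\<^sub>v x \<in> carrier_vec m" "E2 *\<^sub>v x \<in> carrier_vec m"
      using E x by auto
    have 1: "(E0 *\<^sub>v x) \<bullet> (E0 *\<^sub>v x) = (\<Sum>i<n. l i * (x $ i)\<^sup>2)"
      using scalar_prod_mult_mat_vec[OF E(1) E(1) x x] E00 quadratic_form_mat_diag[OF x] by simp
    have "(E0 *\<^sub>v x) \<bullet> (E1 *\<^sub>v x) = (E1 *\<^sub>v x) \<bullet> (E0 *\<^sub>v x)"
      using car by (intro comm_scalar_prod)
    then have 2: "2 * ((E0 *\<^sub>v x) \<bullet> (E1 *\<^sub>v x)) = (\<Sum>i<n. b i * (x $ i)\<^sup>2)"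
      using first_order[OF x] scalar_prod_mult_mat_vec[OF E(1) E(2) x x]
        scalar_prod_mult_mat_vec[OF E(2) E(1) x x] by linarith
    have 3: "(\<Sum>i<n. (l i + \<tau> * b i) * (x $ i)\<^sup>2)
        = (E0 *\<^sub>v x) \<bullet> (E0 *\<^sub>v x) + 2 * \<tau> * ((E0 *\<^sub>v x) \<bullet> (E1 *\<^sub>v x))"
      using arg_cong[OF 2, of "\<lambda>y. \<tau> * y"] unfolding 1
      by (simp add: sum.distrib sum_distrib_left algebra_simps)
    have "(E0 *\<^sub>v x) \<bullet> (E0 *\<^sub>v x) + (E1 *\<^sub>v x) \<bullet> (E1 *\<^sub>v x) + (E2 *\<^sub>v x) \<bullet> (E2 *\<^sub>v x) \<le> (c0 + c1 + c2) * (x \<bullet> x)"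
      using c0(2)[OF x] c1(2)[OF x] c2(2)[OF x] by (simp add: algebra_simps)
    then have 4: "\<tau>\<^sup>2 * (3 * ((E0 *\<^sub>v x) \<bullet> (E0 *\<^sub>v x) + (E1 *\<^sub>v x) \<bullet> (E1 *\<^sub>v x) + (E2 *\<^sub>v x) \<bullet> (E2 *\<^sub>v x)))
        \<le> \<tau>\<^sup>2 * (3 * ((c0 + c1 + c2) * (x \<bullet> x)))"
      by (intro mult_left_mono) auto
    have 5: "\<tau>\<^sup>2 * (3 * ((c0 + c1 + c2) * (x \<bullet> x))) = C * \<tau>\<^sup>2 * (x \<bullet> x)"
      by (simp add: C_def)
    show ?thesis
      unfolding YW[OF x] 3
      using quadratic_expansion[OF car \<tau>] 4 unfolding 5 by (rule order_trans)
  qed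
  have small: "\<forall>\<^sub>F \<tau> in at_right 0. \<forall>i\<in>{..<n}. \<forall>j\<in>{..<n}. i \<le> j \<longrightarrow> l j + \<tau> * b j \<le> l i + \<tau> * b i"
  proof (intro eventually_ball_finite finite_lessThan ballI)
    fix i j assume ij: "i \<in> {..<n}" "j \<in> {..<n}"
    consider "j < i" | "i \<le> j" "l i = l j" | "i \<le> j" "l j < l i"
      using lanti[of i j] ij by fastforce
    then show "\<forall>\<^sub>F \<tau> in at_right 0. i \<le> j \<longrightarrow> l j + \<tau> * b j \<le> l i + \<tau> * b i"
    proof cases
      case 2
      then have "b j \<le> b i" using banti ij by auto
      then show ?thesis using 2 by (auto intro!: eventually_at_rightI[of 0 1] mult_left_mono)
    next
      case 3
      have "((\<lambda>\<tau>. (l i + \<tau> * b i) - (l j + \<tau> * b j)) \<longlongrightarrow> (l i + 0 * b i) - (l j + 0 * b j)) (at_right 0)"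
        by (intro tendsto_intros)
      then have "\<forall>\<^sub>F \<tau> in at_right 0. (l i + \<tau> * b i) - (l j + \<tau> * b j) > 0"
        using 3 by (intro order_tendstoD(1)) auto
      then show ?thesis by eventually_elim simp
    qed (auto intro: always_eventually)
  qed
  have "\<forall>\<^sub>F \<tau>::real in at_right 0. 0 < \<tau> \<and> \<tau> \<le> 1"
    by (rule eventually_at_rightI[of 0 1]) auto
  then have "\<forall>\<^sub>F \<tau> in at_right 0. \<forall>i<n.
    \<bar>eigvals_desc ((X + \<tau> \<cdot>\<^sub>m D)\<^sup>T * (X + \<tau> \<cdot>\<^sub>m D)) ! i - (l i + \<tau> * b i)\<bar> \<le> (C + k * L) * \<tau>\<^sup>2"
    using small
  proof eventually_elim
    case (elim \<tau>)
    then have \<tau>: "0 < \<tau>" "\<tau> \<le> 1"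
      and anti: "\<And>i j. i \<le> j \<Longrightarrow> j < n \<Longrightarrow> l j + \<tau> * b j \<le> l i + \<tau> * b i" by auto
    let ?Y = "X + \<tau> \<cdot>\<^sub>m D" and ?r = "\<lambda>i. l i + \<tau> * b i"
    let ?e = "\<lambda>i. eigvals_desc (?Y\<^sup>T * ?Y) ! i"
    have Y: "?Y \<in> carrier_mat m n" using X D by simp
    have kexp: "(W \<tau> *\<^sub>v x) \<bullet> (W \<tau> *\<^sub>v x) \<le> (1 + k * \<tau>\<^sup>2) * (x \<bullet> x)" if "x \<in> carrier_vec n" for x
      using mult_left_mono[OF k(2)[OF that], of "\<tau>\<^sup>2"] by (simp add: Wnorm[OF that] algebra_simps)
    have up: "?e i \<le> ?r i + C * \<tau>\<^sup>2" if i: "i < n" for i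
    proof (rule gram_eigval_upper[OF Y W i])
      fix x :: "real vec" assume x: "x \<in> carrier_vec n" and x0: "\<And>j. j < i \<Longrightarrow> x $ j = 0"
      have "(\<Sum>j<n. ?r j * (x $ j)\<^sup>2) \<le> (\<Sum>j<n. ?r i * (x $ j)\<^sup>2)"
      proof (intro sum_mono)
        fix j assume "j \<in> {..<n}"
        then show "?r j * (x $ j)\<^sup>2 \<le> ?r i * (x $ j)\<^sup>2"
          using anti[of i j] x0[of j] by (cases "j < i") (auto intro!: mult_right_mono)
      qed
      also have "\<dots> = ?r i * (x \<bullet> x)" by (simp add: scalar_prod_self_sum[OF x] sum_distrib_left)
      finally show "(?Y *\<^sub>v (W \<tau> *\<^sub>v x)) \<bullet> (?Y *\<^sub>v (W \<tau> *\<^sub>v x)) \<le> (?r i + C * \<tau>\<^sup>2) * (x \<bullet> x)"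
        using quad[OF x \<tau>] by (simp add: abs_le_iff distrib_right)
    qed (simp add: Wnorm scalar_prod_self_nonneg)
    have low: "?r i - C * \<tau>\<^sup>2 \<le> (1 + k * \<tau>\<^sup>2) * ?e i" if i: "i < n" for i
    proof (rule gram_eigval_lower[OF Y W i])
      fix x :: "real vec" assume x: "x \<in> carrier_vec n" and x0: "\<And>j. i < j \<Longrightarrow> j < n \<Longrightarrow> x $ j = 0"
      have "?r i * (x \<bullet> x) = (\<Sum>j<n. ?r i * (x $ j)\<^sup>2)"
        by (simp add: scalar_prod_self_sum[OF x] sum_distrib_left)
      also have "\<dots> \<le> (\<Sum>j<n. ?r j * (x $ j)\<^sup>2)"
      proof (intro sum_mono)
        fix j assume "j \<in> {..<n}"
        then show "?r i * (x $ j)\<^sup>2 \<le> ?r j * (x $ j)\<^sup>2"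
          using anti[of j i] x0[of j] i by (cases "i < j") (auto intro!: mult_right_mono)
      qed
      finally show "(?r i - C * \<tau>\<^sup>2) * (x \<bullet> x) \<le> (?Y *\<^sub>v (W \<tau> *\<^sub>v x)) \<bullet> (?Y *\<^sub>v (W \<tau> *\<^sub>v x))"
        using quad[OF x \<tau>] by (simp add: abs_le_iff left_diff_distrib)
    qed (rule kexp)
    show ?case
    proof (intro allI impI)
      fix i assume i: "i < n"
      have "\<bar>l i\<bar> \<le> (\<Sum>i<n. \<bar>l i\<bar>)" "\<bar>b i\<bar> \<le> (\<Sum>i<n. \<bar>b i\<bar>)"
        using i by (auto intro!: member_le_sum[of i _ "\<lambda>i. \<bar>_ i\<bar>"])
      moreover have "\<tau> * b i \<le> \<bar>b i\<bar>"
        using \<tau> by (metis abs_ge_self abs_mult abs_of_pos dual_order.trans mult_left_le_one_le abs_ge_zero less_imp_le)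
      moreover have "C * \<tau>\<^sup>2 \<le> C"
        using \<tau> C0 by (simp add: mult_left_le power_le_one)
      ultimately have "?e i \<le> L" using up[OF i] unfolding L_def by linarith
      then have "k * \<tau>\<^sup>2 * ?e i \<le> k * \<tau>\<^sup>2 * L"
        using k by (intro mult_left_mono) auto
      moreover have "0 \<le> k * L * \<tau>\<^sup>2"
      proof -
        have "0 \<le> L" unfolding L_def using C0 by (intro add_nonneg_nonneg sum_nonneg) auto
        then show ?thesis using k by simp
      qed
      ultimately show "\<bar>?e i - ?r i\<bar> \<le> (C + k * L) * \<tau>\<^sup>2"
        using up[OF i] low[OF i] by (simp add: abs_le_iff algebra_simps)
    qed
  qed
  then show ?thesis by blast
qed

section \<open>The derivative of the Ky Fan norm in an adapted basis\<close>

lemma right_derivative_chain: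
  fixes e f :: "real \<Rightarrow> real"
  assumes f: "(f has_real_derivative d) (at l)"
    and e: "((\<lambda>\<tau>. (e \<tau> - l) / \<tau>) \<longlongrightarrow> b) (at_right 0)"
  shows "((\<lambda>\<tau>. (f (e \<tau>) - f l) / \<tau>) \<longlongrightarrow> d * b) (at_right 0)"
proof -
  \<comment> \<open>Differentiability at 0 needs the value \<open>l\<close> there, which \<open>e\<close> itself may miss.\<close>
  define g where "g \<tau> = (if \<tau> = 0 then l else e \<tau>)" for \<tau>
  have ev: "\<forall>\<^sub>F \<tau>::real in at_right 0. \<tau> > 0"
    by (rule eventually_at_right_less)
  have "((\<lambda>\<tau>. (g \<tau> - g 0) / (\<tau> - 0)) \<longlongrightarrow> b) (at_right 0)"
    using e by (rule Lim_transform_eventually) (use ev in eventually_elim, simp add: g_def)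
  then have "(g has_real_derivative b) (at_right 0)"
    by (simp add: has_field_derivative_iff)
  then have "((\<lambda>\<tau>. f (g \<tau>)) has_real_derivative d * b) (at_right 0)"
    using f by (intro DERIV_chain2[where f = f and g = g]) (auto simp: g_def)
  then have "((\<lambda>\<tau>. (f (g \<tau>) - f (g 0)) / (\<tau> - 0)) \<longlongrightarrow> d * b) (at_right 0)"
    by (simp add: has_field_derivative_iff)
  then show ?thesis
    by (rule Lim_transform_eventually) (use ev in eventually_elim, simp add: g_def)
qed

lemma tendsto_zero_if_bounded:
  fixes f g :: "'a \<Rightarrow> real"
  assumes "\<forall>\<^sub>F x in F. norm (f x) \<le> g x" and "(g \<longlongrightarrow> 0) F"
  shows "(f \<longlongrightarrow> 0) F"
  using assms(2) by (rule tendsto_0_le[where K = 1]) (use assms(1) in eventually_elim, simp)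

text \<open>For \<open>l > 0\<close> this is the chain rule. For \<open>l = 0\<close> the power is not differentiable at \<open>l\<close> when \<open>p < 2\<close>, but
\<open>e \<tau> = O(\<tau>\<^sup>2)\<close> gives \<open>e \<tau> powr (p / 2) = O(\<tau> powr p)\<close>, which is \<open>o(\<tau>)\<close> because \<open>p > 1\<close>; the formula
then yields 0.\<close>

lemma right_derivative_half_powr:
  fixes e :: "real \<Rightarrow> real"
  assumes p: "1 < p" and l: "0 \<le> l" and b0: "l = 0 \<Longrightarrow> b = 0"
    and e0: "\<And>\<tau>. 0 \<le> e \<tau>"
    and e: "\<forall>\<^sub>F \<tau> in at_right 0. \<bar>e \<tau> - (l + \<tau> * b)\<bar> \<le> C * \<tau>\<^sup>2"
  shows "((\<lambda>\<tau>. (e \<tau> powr (p / 2) - l powr (p / 2)) / \<tau>) \<longlongrightarrow> p / 2 * l powr (p / 2 - 1) * b) (at_right 0)"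
proof -
  have pos: "\<forall>\<^sub>F \<tau>::real in at_right 0. \<tau> > 0"
    by (rule eventually_at_right_less)
  show ?thesis
  proof (cases "l = 0")
    case False
    have "((\<lambda>\<tau>. (e \<tau> - l) / \<tau> - b) \<longlongrightarrow> 0) (at_right 0)"
    proof (rule tendsto_zero_if_bounded)
      show "\<forall>\<^sub>F \<tau> in at_right 0. norm ((e \<tau> - l) / \<tau> - b) \<le> C * \<tau>"
        using e pos
      proof eventually_elim
        case (elim \<tau>)
        have "norm ((e \<tau> - l) / \<tau> - b) = \<bar>e \<tau> - (l + \<tau> * b)\<bar> / \<tau>"
          using elim(2) by (simp add: field_simps flip: abs_divide) (simp add: abs_divide)
        also have "\<dots> \<le> C * \<tau>\<^sup>2 / \<tau>" using elim by (intro divide_right_mono) auto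
        finally show ?case using elim(2) by (simp add: power2_eq_square)
      qed
      have "((\<lambda>\<tau>. C * \<tau>) \<longlongrightarrow> C * 0) (at_right 0)" by (intro tendsto_intros)
      then show "((\<lambda>\<tau>. C * \<tau>) \<longlongrightarrow> 0) (at_right 0)" by simp
    qed
    then have "((\<lambda>\<tau>. (e \<tau> - l) / \<tau>) \<longlongrightarrow> b) (at_right 0)"
      by (rule LIM_zero_cancel)
    moreover have "((\<lambda>x. x powr (p / 2)) has_real_derivative p / 2 * l powr (p / 2 - 1)) (at l)"
      using l False by (intro has_real_derivative_powr) simp
    ultimately show ?thesis by (intro right_derivative_chain)
  next
    case True
    define c where "c = max C 0"
    have "((\<lambda>\<tau>. e \<tau> powr (p / 2) / \<tau>) \<longlongrightarrow> 0) (at_right 0)"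
    proof (rule tendsto_zero_if_bounded)
      show "\<forall>\<^sub>F \<tau> in at_right 0. norm (e \<tau> powr (p / 2) / \<tau>) \<le> c powr (p / 2) * \<tau> powr (p - 1)"
        using e pos
      proof eventually_elim
        case (elim \<tau>)
        have "e \<tau> \<le> C * \<tau>\<^sup>2" using elim(1) True b0 e0[of \<tau>] by simp
        also have "\<dots> \<le> c * \<tau>\<^sup>2" by (intro mult_right_mono) (auto simp: c_def)
        finally have "e \<tau> powr (p / 2) \<le> (c * \<tau>\<^sup>2) powr (p / 2)"
          using e0 p by (intro powr_mono2) auto
        also have "\<dots> = c powr (p / 2) * (\<tau> powr 2) powr (p / 2)"
          using elim(2) by (simp add: powr_mult c_def)
        also have "\<dots> = c powr (p / 2) * \<tau> powr p" by (simp add: powr_powr)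
        also have "\<dots> = c powr (p / 2) * \<tau> powr (p - 1) * \<tau>"
          using elim(2) by (simp add: powr_diff)
        finally show ?case using elim(2) by (simp add: divide_le_eq)
      qed
      have "((\<lambda>\<tau>::real. \<tau> powr (p - 1)) \<longlongrightarrow> 0) (at_right 0)"
        using p pos by (intro tendsto_zero_powrI[where b = "p - 1"])
          (auto intro: tendsto_intros elim: eventually_mono)
      then have "((\<lambda>\<tau>. c powr (p / 2) * \<tau> powr (p - 1)) \<longlongrightarrow> c powr (p / 2) * 0) (at_right 0)"
        by (intro tendsto_intros)
      then show "((\<lambda>\<tau>. c powr (p / 2) * \<tau> powr (p - 1)) \<longlongrightarrow> 0) (at_right 0)" by simp
    qed
    then show ?thesis using True b0 by simp
  qed
qed

lemma singval_square:
  assumes "Y \<in> carrier_mat m n" and "i < n"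
  shows "(singval Y (Suc i))\<^sup>2 = eigvals_desc (Y\<^sup>T * Y) ! i" "singval Y (Suc i) \<ge> 0"
  using gram_eigvals_nonneg[OF assms] by (auto simp: singval_def eigval_def)

lemma ky_fan_norm_eigvals:
  assumes Y: "Y \<in> carrier_mat m n" and k: "k \<le> n"
  shows "ky_fan_norm k p Y = (\<Sum>i<k. eigvals_desc (Y\<^sup>T * Y) ! i powr (p / 2)) powr (1 / p)"
proof -
  have "(\<Sum>i=1..k. singval Y i powr p) = (\<Sum>i<k. singval Y (Suc i) powr p)"
    by (simp add: sum.atLeast1_atMost_eq)
  also have "\<dots> = (\<Sum>i<k. eigvals_desc (Y\<^sup>T * Y) ! i powr (p / 2))"
  proof (intro sum.cong refl)
    fix i assume "i \<in> {..<k}"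
    then have "eigvals_desc (Y\<^sup>T * Y) ! i \<ge> 0" using gram_eigvals_nonneg[OF Y] k by simp
    then show "singval Y (Suc i) powr p = eigvals_desc (Y\<^sup>T * Y) ! i powr (p / 2)"
      by (simp add: singval_def eigval_def powr_half_sqrt[symmetric] powr_powr)
  qed
  finally show ?thesis by (simp add: ky_fan_norm_def)
qed

lemma gram_eigvals_zero_imp_zero:
  fixes X :: "real mat"
  assumes X: "X \<in> carrier_mat m n" and zero: "\<And>i. i < n \<Longrightarrow> eigvals_desc (X\<^sup>T * X) ! i = 0"
  shows "X = 0\<^sub>m m n"
proof -
  obtain P where P: "orthogonal_matrix n P" and PX: "\<And>y. y \<in> carrier_vec n \<Longrightarrow>
      (X *\<^sub>v (P *\<^sub>v y)) \<bullet> (X *\<^sub>v (P *\<^sub>v y)) = (\<Sum>i<n. eigvals_desc (X\<^sup>T * X) ! i * (y $ i)\<^sup>2)"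
    using gram_spectral[OF X] by blast
  note Pd = orthogonal_matrixD[OF P]
  have van: "X *\<^sub>v z = 0\<^sub>v m" if z: "z \<in> carrier_vec n" for z
  proof -
    have "z = P *\<^sub>v (P\<^sup>T *\<^sub>v z)"
      using Pd z assoc_mult_mat_vec[of P n n "P\<^sup>T" n z] by simp
    then have "(X *\<^sub>v z) \<bullet> (X *\<^sub>v z) = 0"
      using PX[of "P\<^sup>T *\<^sub>v z"] zero Pd z by simp
    then show ?thesis using scalar_prod_self_pos[of "X *\<^sub>v z" m] X z by fastforce
  qed
  show ?thesis
  proof (rule eq_matI)
    fix i j assume "i < dim_row (0\<^sub>m m n :: real mat)" "j < dim_col (0\<^sub>m m n :: real mat)"
    then show "X $$ (i, j) = 0\<^sub>m m n $$ (i, j)"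
      using arg_cong[OF van[of "unit_vec n j"], of "\<lambda>v. v $ i"] X by simp
  qed (use X in auto)
qed

text \<open>The Ky Fan norm is the \<open>1 / p\<close> power of a sum of \<open>p / 2\<close> powers of Gram eigenvalues, so the eigenvalue
perturbation and the chain rule give its derivative. The inner sum is positive as \<open>X\<close> is nonzero.\<close>

lemma ky_fan_gateaux_derivative:
  fixes X D V :: "real mat" and b :: "nat \<Rightarrow> real"
  defines "l i \<equiv> eigvals_desc (X\<^sup>T * X) ! i"
  assumes X: "X \<in> carrier_mat m n" and D: "D \<in> carrier_mat m n"
    and k: "1 \<le> k" "k \<le> n" and p: "1 < p" and X0: "X \<noteq> 0\<^sub>m m n"
    and V: "orthogonal_matrix n V" and VH: "V\<^sup>T * (X\<^sup>T * X) * V = mat_diag n l"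
    and VB: "\<And>i j. i < n \<Longrightarrow> j < n \<Longrightarrow> l i = l j \<Longrightarrow>
      (V\<^sup>T * (X\<^sup>T * D + D\<^sup>T * X) * V) $$ (i, j) = (if i = j then b i else 0)"
    and banti: "\<And>i j. i \<le> j \<Longrightarrow> j < n \<Longrightarrow> l i = l j \<Longrightarrow> b j \<le> b i"
  shows "has_gateaux_derivative (ky_fan_norm k p) X D
    (1 / ky_fan_norm k p X powr (p - 1) * (\<Sum>i<k. l i powr (p / 2 - 1) * b i / 2))"
proof -
  note Vd = orthogonal_matrixD[OF V]
  have lnn: "l i \<ge> 0" if "i < n" for i using gram_eigvals_nonneg[OF X that] by (simp add: l_def)
  have lanti: "l j \<le> l i" if "i \<le> j" "j < n" for i j
    using spectral_theorem(3)[OF gram_symmetric[OF X] that] by (simp add: l_def)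
  \<comment> \<open>If \<open>l i = 0\<close> then \<open>X\<close> kills the \<open>i\<close>-th basis vector, so the \<open>i\<close>-th diagonal entry of
      the first-order term vanishes.\<close>
  have b0: "b i = 0" if i: "i < n" and li: "l i = 0" for i
  proof -
    define E where "E = X * V"
    have E: "E \<in> carrier_mat m n" using X Vd by (simp add: E_def)
    have "E\<^sup>T * E = mat_diag n l"
      unfolding VH[symmetric] E_def by (rule gram_congruence[OF X Vd(1), symmetric])
    then have "col E i \<bullet> col E i = mat_diag n l $$ (i, i)" using E i
      by (metis carrier_matD(2) index_mult_mat(1) index_transpose_mat(2) row_transpose)
    then have "col E i \<bullet> col E i = 0" using i li by (simp add: mat_diag_def)
    then have z: "col E i = 0\<^sub>v m" using scalar_prod_self_pos[of "col E i" m] E by fastforce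
    define F where "F = E\<^sup>T * (D * V)"
    have F: "F \<in> carrier_mat n n" using E D Vd(1) by (simp add: F_def)
    have "F $$ (i, i) = col E i \<bullet> col (D * V) i"
      using E D Vd(1) i by (simp add: F_def)
    then have Fii: "F $$ (i, i) = 0" unfolding z using D Vd(1) i by (simp del: col_mult2)
    have "b i = (F + F\<^sup>T) $$ (i, i)"
      using VB[OF i i] gram_first_order_congruence[OF X D Vd(1)] by (simp add: F_def E_def)
    then show ?thesis using F Fii i by simp
  qed
  have l0: "l 0 > 0"
  proof (rule ccontr)
    assume "\<not> ?thesis"
    then have "l i = 0" if "i < n" for i using lanti[of 0 i] lnn[of i] that by simp
    then show False using gram_eigvals_zero_imp_zero[OF X] X0 by (simp add: l_def)
  qed
  define Y where "Y \<tau> = X + \<tau> \<cdot>\<^sub>m D" for \<tau>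
  have Y: "Y \<tau> \<in> carrier_mat m n" for \<tau> using X D by (simp add: Y_def)
  define e where "e i \<tau> = eigvals_desc ((Y \<tau>)\<^sup>T * Y \<tau>) ! i" for i \<tau>
  have enn: "e i \<tau> \<ge> 0" if "i < n" for i \<tau> using gram_eigvals_nonneg[OF Y that] by (simp add: e_def)
  obtain C where C: "\<forall>\<^sub>F \<tau> in at_right 0. \<forall>i<n. \<bar>e i \<tau> - (l i + \<tau> * b i)\<bar> \<le> C * \<tau>\<^sup>2"
    using gram_eigval_perturbation[OF X D V, of b] VH VB banti unfolding l_def e_def Y_def by blast
  have der: "((\<lambda>\<tau>. (e i \<tau> powr (p / 2) - l i powr (p / 2)) / \<tau>) \<longlongrightarrow> p / 2 * l i powr (p / 2 - 1) * b i) (at_right 0)"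
    if i: "i < n" for i
    using p lnn[OF i] b0[OF i] enn[OF i]
  proof (rule right_derivative_half_powr)
    show "\<forall>\<^sub>F \<tau> in at_right 0. \<bar>e i \<tau> - (l i + \<tau> * b i)\<bar> \<le> C * \<tau>\<^sup>2"
      using C by eventually_elim (use i in simp)
  qed
  define s where "s \<tau> = (\<Sum>i<k. e i \<tau> powr (p / 2))" for \<tau>
  define s0 where "s0 = (\<Sum>i<k. l i powr (p / 2))"
  have "0 < l 0 powr (p / 2)" using l0 by simp
  also have "\<dots> \<le> s0" unfolding s0_def using k by (intro member_le_sum) auto
  finally have s0: "s0 > 0" .
  have "((\<lambda>\<tau>. \<Sum>i<k. (e i \<tau> powr (p / 2) - l i powr (p / 2)) / \<tau>) \<longlongrightarrow> (\<Sum>i<k. p / 2 * l i powr (p / 2 - 1) * b i)) (at_right 0)"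
    using k by (intro tendsto_sum der) auto
  then have "((\<lambda>\<tau>. (s \<tau> - s0) / \<tau>) \<longlongrightarrow> (\<Sum>i<k. p / 2 * l i powr (p / 2 - 1) * b i)) (at_right 0)"
    by (simp add: s_def s0_def sum_subtractf flip: sum_divide_distrib)
  moreover have "((\<lambda>x. x powr (1 / p)) has_real_derivative 1 / p * s0 powr (1 / p - 1)) (at s0)"
    by (rule has_real_derivative_powr[OF s0])
  ultimately have "((\<lambda>\<tau>. (s \<tau> powr (1 / p) - s0 powr (1 / p)) / \<tau>) \<longlongrightarrow>
      1 / p * s0 powr (1 / p - 1) * (\<Sum>i<k. p / 2 * l i powr (p / 2 - 1) * b i)) (at_right 0)"
    by (intro right_derivative_chain)
  moreover have "ky_fan_norm k p X = s0 powr (1 / p)"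
    using ky_fan_norm_eigvals[OF X k(2)] by (simp add: s0_def l_def)
  moreover have "ky_fan_norm k p (Y \<tau>) = s \<tau> powr (1 / p)" for \<tau>
    using ky_fan_norm_eigvals[OF Y k(2)] by (simp add: s_def e_def)
  moreover have "1 / p * s0 powr (1 / p - 1) * (\<Sum>i<k. p / 2 * l i powr (p / 2 - 1) * b i)
      = 1 / (s0 powr (1 / p)) powr (p - 1) * (\<Sum>i<k. l i powr (p / 2 - 1) * b i / 2)"
  proof -
    have "(\<Sum>i<k. p / 2 * l i powr (p / 2 - 1) * b i) = p * (\<Sum>i<k. l i powr (p / 2 - 1) * b i / 2)"
      by (simp add: sum_distrib_left mult.assoc)
    moreover have "1 / (s0 powr (1 / p)) powr (p - 1) = s0 powr (1 / p - 1)"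
    proof -
      have "- (1 / p * (p - 1)) = 1 / p - 1" using p by (simp add: field_simps)
      then show ?thesis by (simp add: powr_powr flip: powr_minus_divide)
    qed
    ultimately show ?thesis using p by simp
  qed
  ultimately show ?thesis by (simp add: has_gateaux_derivative_def Y_def)
qed

section \<open>Change of eigenbasis\<close>

lemma sum_window:
  fixes h :: "nat \<Rightarrow> real"
  assumes "r + q \<le> n" and "\<And>a. a < n \<Longrightarrow> \<not> (r \<le> a \<and> a < r + q) \<Longrightarrow> h a = 0"
  shows "(\<Sum>a<q. h (r + a)) = (\<Sum>a<n. h a)"
proof -
  have "(\<Sum>a<q. h (r + a)) = (\<Sum>a\<in>{r..<r + q}. h a)"
    by (rule sum.reindex_bij_witness[of _ "\<lambda>a. a - r" "\<lambda>a. r + a"]) auto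
  also have "\<dots> = (\<Sum>a<n. h a)"
    using assms by (intro sum.mono_neutral_left) auto
  finally show ?thesis .
qed

text \<open>The transition matrix between two eigenbases of \<open>H\<close> with the same eigenvalue list commutes with the
diagonal matrix of eigenvalues.\<close>

lemma eigenbasis_change_support:
  fixes H :: "real mat"
  assumes H: "H \<in> carrier_mat n n"
    and V: "orthogonal_matrix n V" "V\<^sup>T * H * V = mat_diag n l"
    and V': "orthogonal_matrix n V'" "V'\<^sup>T * H * V' = mat_diag n l"
    and ij: "i < n" "j < n" and ne: "(V\<^sup>T * V') $$ (i, j) \<noteq> 0"
  shows "l i = l j"
proof -
  note Vd = orthogonal_matrixD[OF V(1)] and Vd' = orthogonal_matrixD[OF V'(1)]
  let ?Q = "V\<^sup>T * V'"
  have Q: "?Q \<in> carrier_mat n n" using Vd Vd' by simp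
  have "mat_diag n l * ?Q = V\<^sup>T * H * (V * V\<^sup>T) * V'"
    unfolding V(2)[symmetric] using H Vd(1) Vd'(1) by (simp add: assoc_mult_mat[of _ n n _ n _ n])
  also have "\<dots> = V\<^sup>T * (V' * V'\<^sup>T) * H * V'"
    using Vd Vd' H by simp
  also have "\<dots> = ?Q * mat_diag n l"
    unfolding V'(2)[symmetric] using H Vd(1) Vd'(1) by (simp add: assoc_mult_mat[of _ n n _ n _ n])
  finally have "(mat_diag n l * ?Q) $$ (i, j) = (?Q * mat_diag n l) $$ (i, j)" by simp
  then have "l i * ?Q $$ (i, j) = ?Q $$ (i, j) * l j"
    unfolding mat_diag_mult_left[OF Q] mat_diag_mult_right[OF Q] using ij by simp
  then show ?thesis using ne by simp
qed

lemma change_of_basis: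
  fixes B :: "real mat"
  assumes B: "B \<in> carrier_mat n n" and V: "orthogonal_matrix n V" and V': "orthogonal_matrix n V'"
  shows "orthogonal_matrix n (V\<^sup>T * V')"
    and "V'\<^sup>T * B * V' = (V\<^sup>T * V')\<^sup>T * (V\<^sup>T * B * V) * (V\<^sup>T * V')"
proof -
  note Vd = orthogonal_matrixD[OF V] and Vd' = orthogonal_matrixD[OF V']
  show "orthogonal_matrix n (V\<^sup>T * V')"
    by (rule orthogonal_matrix_mult[OF orthogonal_matrix_transpose[OF V] V'])
  have "(V\<^sup>T * V')\<^sup>T * (V\<^sup>T * B * V) * (V\<^sup>T * V') = V'\<^sup>T * (V * V\<^sup>T) * B * (V * V\<^sup>T) * V'"
    using Vd(1) Vd'(1) B by (simp add: transpose_mult[of _ n n _ n] assoc_mult_mat[of _ n n _ n _ n])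
  also have "\<dots> = V'\<^sup>T * B * V'" using Vd Vd' B by simp
  finally show "V'\<^sup>T * B * V' = (V\<^sup>T * V')\<^sup>T * (V\<^sup>T * B * V) * (V\<^sup>T * V')" by simp
qed

text \<open>With \<open>Q\<close> the transition matrix, both sides are the trace of \<open>f(H) B\<close>: the diagonal matrix of the weights
\<open>f (l i)\<close> commutes with \<open>Q\<close>.\<close>

lemma weighted_trace_basis_independent:
  fixes H B :: "real mat"
  assumes H: "H \<in> carrier_mat n n" and B: "B \<in> carrier_mat n n"
    and V: "orthogonal_matrix n V" "V\<^sup>T * H * V = mat_diag n l"
    and V': "orthogonal_matrix n V'" "V'\<^sup>T * H * V' = mat_diag n l"
  shows "(\<Sum>i<n. f (l i) * (V'\<^sup>T * B * V') $$ (i, i)) = (\<Sum>i<n. f (l i) * (V\<^sup>T * B * V) $$ (i, i))"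
proof -
  note Vd = orthogonal_matrixD[OF V(1)]
  define Q where "Q = V\<^sup>T * V'"
  define C where "C = V\<^sup>T * B * V"
  have Q: "orthogonal_matrix n Q" and VBQ: "V'\<^sup>T * B * V' = Q\<^sup>T * C * Q"
    using change_of_basis[OF B V(1) V'(1)] by (auto simp: Q_def C_def)
  note Qd = orthogonal_matrixD[OF Q]
  have C: "C \<in> carrier_mat n n" using Vd B by (simp add: C_def)
  have supp: "Q $$ (a, i) = 0 \<or> f (l i) = f (l a)" if "a < n" "i < n" for a i
    using eigenbasis_change_support[OF H V V' that] unfolding Q_def by metis
  have rows: "(\<Sum>i<n. Q $$ (a, i) * Q $$ (c, i)) = (if a = c then 1 else 0)" if "a < n" "c < n" for a c
    using orthogonal_matrix_cols_sum[OF orthogonal_matrix_transpose[OF Q] that] Qd(1) that by simp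
  have "(\<Sum>i<n. f (l i) * (V'\<^sup>T * B * V') $$ (i, i))
      = (\<Sum>i<n. \<Sum>a<n. \<Sum>c<n. f (l i) * Q $$ (a, i) * (C $$ (a, c) * Q $$ (c, i)))"
    unfolding VBQ by (intro sum.cong refl, subst index_congruence[OF Qd(1) C Qd(1)])
      (auto simp: sum_distrib_left mult.assoc)
  also have "\<dots> = (\<Sum>i<n. \<Sum>a<n. \<Sum>c<n. f (l a) * C $$ (a, c) * (Q $$ (a, i) * Q $$ (c, i)))"
    by (intro sum.cong refl) (use supp in fastforce)
  also have "\<dots> = (\<Sum>a<n. \<Sum>i<n. \<Sum>c<n. f (l a) * C $$ (a, c) * (Q $$ (a, i) * Q $$ (c, i)))"
    by (rule sum.swap)
  also have "\<dots> = (\<Sum>a<n. \<Sum>c<n. \<Sum>i<n. f (l a) * C $$ (a, c) * (Q $$ (a, i) * Q $$ (c, i)))"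
    by (intro sum.cong refl sum.swap)
  also have "\<dots> = (\<Sum>a<n. \<Sum>c<n. f (l a) * C $$ (a, c) * (\<Sum>i<n. Q $$ (a, i) * Q $$ (c, i)))"
    by (simp add: sum_distrib_left)
  also have "\<dots> = (\<Sum>a<n. \<Sum>c<n. if a = c then f (l a) * C $$ (a, a) else 0)"
    by (intro sum.cong refl) (simp add: rows)
  also have "\<dots> = (\<Sum>a<n. f (l a) * C $$ (a, a))" by simp
  finally show ?thesis by (simp add: C_def)
qed

text \<open>The transition matrix does not connect the block \<open>r, ..., r + q - 1\<close> of equal eigenvalues with the other
indices, so its restriction to the block is orthogonal. It diagonalises the compression of \<open>B\<close> to the block,
with the entries \<open>b\<close>, and \<open>M\<close> is \<open>c\<close> times this compression.\<close>

lemma block_eigvals: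
  fixes H B :: "real mat"
  assumes H: "H \<in> carrier_mat n n" and B: "B \<in> carrier_mat n n"
    and V: "orthogonal_matrix n V" "V\<^sup>T * H * V = mat_diag n l"
    and V': "orthogonal_matrix n V'" "V'\<^sup>T * H * V' = mat_diag n l"
    and VB: "\<And>i j. i < n \<Longrightarrow> j < n \<Longrightarrow> l i = l j \<Longrightarrow>
      (V'\<^sup>T * B * V') $$ (i, j) = (if i = j then b i else 0)"
    and banti: "\<And>i j. i \<le> j \<Longrightarrow> j < n \<Longrightarrow> l i = l j \<Longrightarrow> b j \<le> b i"
    and rq: "r + q \<le> n" and block: "\<And>i. i < n \<Longrightarrow> l i = \<mu> \<longleftrightarrow> r \<le> i \<and> i < r + q"
    and M: "M \<in> carrier_mat q q" and c: "c \<ge> 0"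
    and Mij: "\<And>i j. i < q \<Longrightarrow> j < q \<Longrightarrow> M $$ (i, j) = c * (V\<^sup>T * B * V) $$ (r + i, r + j)"
  shows "eigvals_desc M = map (\<lambda>i. c * b (r + i)) [0..<q]"
proof -
  note Vd = orthogonal_matrixD[OF V(1)]
  define Q where "Q = V\<^sup>T * V'"
  define C where "C = V\<^sup>T * B * V"
  have Q: "orthogonal_matrix n Q" and VBQ: "V'\<^sup>T * B * V' = Q\<^sup>T * C * Q"
    using change_of_basis[OF B V(1) V'(1)] by (auto simp: Q_def C_def)
  note Qd = orthogonal_matrixD[OF Q]
  have C: "C \<in> carrier_mat n n" using Vd B by (simp add: C_def)
  have blk: "l (r + i) = \<mu>" if "i < q" for i using block[of "r + i"] rq that by simp
  have supp: "Q $$ (a, r + i) = 0" if "a < n" "i < q" "\<not> (r \<le> a \<and> a < r + q)" for a i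
  proof (rule ccontr)
    assume "Q $$ (a, r + i) \<noteq> 0"
    then have "l a = l (r + i)"
      using eigenbasis_change_support[OF H V V' that(1), of "r + i"] that rq by (simp add: Q_def)
    then show False using blk block that by simp
  qed
  define R where "R = mat q q (\<lambda>(i, j). Q $$ (r + i, r + j))"
  have R: "R \<in> carrier_mat q q" by (simp add: R_def)
  have "R\<^sup>T * R = 1\<^sub>m q"
  proof (rule eq_matI)
    fix i j assume "i < dim_row (1\<^sub>m q :: real mat)" "j < dim_col (1\<^sub>m q :: real mat)"
    then have ij: "i < q" "j < q" by auto
    have "(R\<^sup>T * R) $$ (i, j) = (\<Sum>a<q. Q $$ (r + a, r + i) * Q $$ (r + a, r + j))"
      using index_mult_mat_sum[of "R\<^sup>T" q q R q i j] R ij by (simp add: R_def del: index_mult_mat)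
    also have "\<dots> = (\<Sum>a<n. Q $$ (a, r + i) * Q $$ (a, r + j))"
      using supp ij by (intro sum_window[OF rq]) auto
    also have "\<dots> = (if i = j then 1 else 0)"
      using orthogonal_matrix_cols_sum[OF Q, of "r + i" "r + j"] ij rq by simp
    finally show "(R\<^sup>T * R) $$ (i, j) = 1\<^sub>m q $$ (i, j)" using ij by simp
  qed (use R in auto)
  then have Ro: "orthogonal_matrix q R" using R by (rule orthogonal_matrixI[rotated])
  have "R\<^sup>T * M * R = mat_diag q (\<lambda>i. c * b (r + i))"
  proof (rule eq_matI)
    fix i j assume "i < dim_row (mat_diag q (\<lambda>i. c * b (r + i)))" "j < dim_col (mat_diag q (\<lambda>i. c * b (r + i)))"
    then have ij: "i < q" "j < q" by (auto simp: mat_diag_def)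
    have "(R\<^sup>T * M * R) $$ (i, j) = (\<Sum>a<q. \<Sum>d<q. Q $$ (r + a, r + i) * (c * C $$ (r + a, r + d)) * Q $$ (r + d, r + j))"
      using ij by (subst index_congruence[OF R M R]) (auto simp: R_def Mij C_def intro!: sum.cong)
    also have "\<dots> = c * (\<Sum>a<q. \<Sum>d<q. Q $$ (r + a, r + i) * C $$ (r + a, r + d) * Q $$ (r + d, r + j))"
      by (simp add: sum_distrib_left mult.left_commute mult.assoc)
    also have "(\<Sum>a<q. \<Sum>d<q. Q $$ (r + a, r + i) * C $$ (r + a, r + d) * Q $$ (r + d, r + j))
        = (\<Sum>a<q. \<Sum>d<n. Q $$ (r + a, r + i) * C $$ (r + a, d) * Q $$ (d, r + j))"
      using supp ij by (intro sum.cong refl sum_window[OF rq]) auto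
    also have "\<dots> = (\<Sum>a<n. \<Sum>d<n. Q $$ (a, r + i) * C $$ (a, d) * Q $$ (d, r + j))"
      using supp ij by (intro sum_window[OF rq]) auto
    also have "\<dots> = (V'\<^sup>T * B * V') $$ (r + i, r + j)"
      unfolding VBQ using ij rq by (subst index_congruence[OF Qd(1) C Qd(1)]) auto
    also have "\<dots> = (if i = j then b (r + i) else 0)"
      using VB[of "r + i" "r + j"] ij rq blk by simp
    finally show "(R\<^sup>T * M * R) $$ (i, j) = mat_diag q (\<lambda>i. c * b (r + i)) $$ (i, j)"
      using ij by (simp add: mat_diag_def)
  qed (use R in \<open>auto simp: mat_diag_def\<close>)
  moreover have "c * b (r + j) \<le> c * b (r + i)" if "i \<le> j" "j < q" for i j
    using banti[of "r + i" "r + j"] blk[of i] blk[of j] that rq c by (intro mult_left_mono) auto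
  ultimately show ?thesis by (intro eigvals_desc_unique[OF M Ro])
qed

section \<open>Scaling, singular value decompositions and submatrices\<close>

lemma has_gateaux_derivative_unique:
  assumes "has_gateaux_derivative \<phi> X D L"
  shows "gateaux_derivative \<phi> X D = L"
  unfolding gateaux_derivative_def
proof (rule the_equality)
  show "has_gateaux_derivative \<phi> X D L" by fact
  show "L' = L" if "has_gateaux_derivative \<phi> X D L'" for L'
    using that assms tendsto_unique[OF trivial_limit_at_right_real]
    unfolding has_gateaux_derivative_def by blast
qed

text \<open>Scaling \<open>D\<close> by \<open>\<tau>\<close> scales the eigenvalues of its Gram matrix by \<open>\<tau>\<^sup>2\<close>. This settles the derivative at the
zero matrix.\<close>

lemma ky_fan_norm_scale:
  assumes D: "D \<in> carrier_mat m n" and k: "k \<le> n" and p: "1 < p" and \<tau>: "0 \<le> \<tau>"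
  shows "ky_fan_norm k p (\<tau> \<cdot>\<^sub>m D) = \<tau> * ky_fan_norm k p D"
proof -
  let ?e = "\<lambda>i. eigvals_desc (D\<^sup>T * D) ! i"
  note G = gram_symmetric[OF D]
  obtain P where P: "orthogonal_matrix n P" and PD: "P\<^sup>T * (D\<^sup>T * D) * P = mat_diag n ?e"
    using spectral_theorem(1)[OF G] by blast
  note Pd = orthogonal_matrixD[OF P]
  have sc: "(\<tau> \<cdot>\<^sub>m D)\<^sup>T * (\<tau> \<cdot>\<^sub>m D) = \<tau>\<^sup>2 \<cdot>\<^sub>m (D\<^sup>T * D)"
    using D by (intro eq_matI) (auto simp: power2_eq_square scalar_prod_def sum_distrib_left algebra_simps)
  have "P\<^sup>T * (\<tau>\<^sup>2 \<cdot>\<^sub>m (D\<^sup>T * D)) * P = \<tau>\<^sup>2 \<cdot>\<^sub>m (P\<^sup>T * (D\<^sup>T * D) * P)"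
    using Pd(1) G(1) by (simp add: mult_smult_distrib[of _ n n _ n] mult_smult_assoc_mat[of _ n n _ n] del: assoc_mult_mat)
  also have "\<dots> = mat_diag n (\<lambda>i. \<tau>\<^sup>2 * ?e i)"
    unfolding PD by (intro eq_matI) (auto simp: mat_diag_def)
  finally have "P\<^sup>T * (\<tau>\<^sup>2 \<cdot>\<^sub>m (D\<^sup>T * D)) * P = mat_diag n (\<lambda>i. \<tau>\<^sup>2 * ?e i)" .
  then have "eigvals_desc (\<tau>\<^sup>2 \<cdot>\<^sub>m (D\<^sup>T * D)) = map (\<lambda>i. \<tau>\<^sup>2 * ?e i) [0..<n]"
    using G(1) spectral_theorem(3)[OF G] by (intro eigvals_desc_unique[OF _ P]) (auto intro: mult_left_mono)
  then have ev: "eigvals_desc ((\<tau> \<cdot>\<^sub>m D)\<^sup>T * (\<tau> \<cdot>\<^sub>m D)) ! i = \<tau>\<^sup>2 * ?e i" if "i < n" for i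
    using that by (simp add: sc)
  have tp: "(\<tau>\<^sup>2 * x) powr (p / 2) = \<tau> powr p * x powr (p / 2)" if "x \<ge> 0" for x
  proof -
    have "(\<tau>\<^sup>2) powr (p / 2) = \<tau> powr p"
      using \<tau> p by (cases "\<tau> = 0") (auto simp: powr_powr simp flip: powr_numeral)
    then show ?thesis using that by (simp add: powr_mult)
  qed
  have "ky_fan_norm k p (\<tau> \<cdot>\<^sub>m D) = (\<Sum>i<k. (\<tau>\<^sup>2 * ?e i) powr (p / 2)) powr (1 / p)"
    using ky_fan_norm_eigvals[of "\<tau> \<cdot>\<^sub>m D" m n k p] D k by (simp add: ev)
  also have "(\<Sum>i<k. (\<tau>\<^sup>2 * ?e i) powr (p / 2)) = (\<Sum>i<k. \<tau> powr p * ?e i powr (p / 2))"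
    using gram_eigvals_nonneg[OF D] k by (intro sum.cong refl tp) auto
  also have "\<dots> powr (1 / p) = (\<tau> powr p * (\<Sum>i<k. ?e i powr (p / 2))) powr (1 / p)"
    by (simp add: sum_distrib_left)
  also have "\<dots> = \<tau> * ky_fan_norm k p D"
    using p \<tau> ky_fan_norm_eigvals[OF D k, of p] by (simp add: powr_mult powr_powr sum_nonneg)
  finally show ?thesis .
qed

lemma ky_fan_gateaux_derivative_zero:
  assumes D: "D \<in> carrier_mat m n" and k: "k \<le> n" and p: "1 < p"
  shows "ky_fan_norm k p (0\<^sub>m m n) = 0"
    and "has_gateaux_derivative (ky_fan_norm k p) (0\<^sub>m m n) D (ky_fan_norm k p D)"
proof -
  have "0 \<cdot>\<^sub>m D = 0\<^sub>m m n" using D by (intro eq_matI) auto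
  then show zero: "ky_fan_norm k p (0\<^sub>m m n) = 0"
    using ky_fan_norm_scale[OF D k p, of 0] by simp
  have "\<forall>\<^sub>F \<tau> in at_right 0. ky_fan_norm k p D =
      (ky_fan_norm k p (0\<^sub>m m n + \<tau> \<cdot>\<^sub>m D) - ky_fan_norm k p (0\<^sub>m m n)) / \<tau>"
    using eventually_at_right_less[of "0 :: real"]
  proof eventually_elim
    case (elim \<tau>)
    then show ?case using D ky_fan_norm_scale[OF D k p, of \<tau>] by (simp add: zero)
  qed
  then show "has_gateaux_derivative (ky_fan_norm k p) (0\<^sub>m m n) D (ky_fan_norm k p D)"
    unfolding has_gateaux_derivative_def by (rule Lim_transform_eventually[OF tendsto_const])
qed

text \<open>The basis is returned together with the derivative, because the formula for a given singular value
decomposition is obtained by comparing the two bases.\<close>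

lemma ky_fan_gateaux_adapted_basis:
  fixes X D :: "real mat"
  defines "l i \<equiv> eigvals_desc (X\<^sup>T * X) ! i"
  assumes X: "X \<in> carrier_mat m n" and D: "D \<in> carrier_mat m n"
    and k: "1 \<le> k" "k \<le> n" and p: "1 < p" and X0: "X \<noteq> 0\<^sub>m m n"
  obtains V b where "orthogonal_matrix n V" and "V\<^sup>T * (X\<^sup>T * X) * V = mat_diag n l"
    and "\<And>i j. i < n \<Longrightarrow> j < n \<Longrightarrow> l i = l j \<Longrightarrow>
      (V\<^sup>T * (X\<^sup>T * D + D\<^sup>T * X) * V) $$ (i, j) = (if i = j then b i else 0)"
    and "\<And>i j. i \<le> j \<Longrightarrow> j < n \<Longrightarrow> l i = l j \<Longrightarrow> b j \<le> b i"
    and "has_gateaux_derivative (ky_fan_norm k p) X D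
      (1 / ky_fan_norm k p X powr (p - 1) * (\<Sum>i<k. l i powr (p / 2 - 1) * b i / 2))"
proof -
  have "\<exists>V b. orthogonal_matrix n V \<and> V\<^sup>T * (X\<^sup>T * X) * V = mat_diag n l \<and>
    (\<forall>i<n. \<forall>j<n. l i = l j \<longrightarrow>
      (V\<^sup>T * (X\<^sup>T * D + D\<^sup>T * X) * V) $$ (i, j) = (if i = j then b i else 0)) \<and>
    (\<forall>i j. i \<le> j \<and> j < n \<and> l i = l j \<longrightarrow> b j \<le> (b i :: real))"
    unfolding l_def by (rule simultaneous_diagonalisation[OF gram_symmetric[OF X] gram_first_order_symmetric[OF X D]])
  then obtain V b where V: "orthogonal_matrix n V" "V\<^sup>T * (X\<^sup>T * X) * V = mat_diag n l"
    and VB: "\<forall>i<n. \<forall>j<n. l i = l j \<longrightarrow>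
      (V\<^sup>T * (X\<^sup>T * D + D\<^sup>T * X) * V) $$ (i, j) = (if i = j then b i else 0)"
    and b: "\<forall>i j. i \<le> j \<and> j < n \<and> l i = l j \<longrightarrow> b j \<le> b i"
    by (elim exE conjE)
  have VB': "(V\<^sup>T * (X\<^sup>T * D + D\<^sup>T * X) * V) $$ (i, j) = (if i = j then b i else 0)"
    if "i < n" "j < n" "l i = l j" for i j
    by (rule VB[rule_format, OF that])
  have b': "b j \<le> b i" if "i \<le> j" "j < n" "l i = l j" for i j
    by (rule b[rule_format]) (use that in simp)
  have der: "has_gateaux_derivative (ky_fan_norm k p) X D
      (1 / ky_fan_norm k p X powr (p - 1) * (\<Sum>i<k. l i powr (p / 2 - 1) * b i / 2))"
    unfolding l_def
    by (rule ky_fan_gateaux_derivative[OF X D k p X0 V(1)], fold l_def, (fact V(2) VB' b')+)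
  show ?thesis by (rule that[OF V VB' b' der])
qed

text \<open>A singular value decomposition says \<open>X V = U S\<close>, so the right singular vectors are an eigenbasis of the Gram
matrix, and in that basis its first-order term is expressed through the matrix \<open>U\<^sup>T D V\<close>.\<close>

lemma full_svd_facts:
  fixes X D :: "real mat"
  assumes X: "X \<in> carrier_mat m n" and D: "D \<in> carrier_mat m n" and nm: "n \<le> m"
    and svd: "full_svd m n X U S V"
  shows "V\<^sup>T * (X\<^sup>T * X) * V = mat_diag n (\<lambda>i. eigvals_desc (X\<^sup>T * X) ! i)"
    and "\<And>i j. i < n \<Longrightarrow> j < n \<Longrightarrow> (V\<^sup>T * (X\<^sup>T * D + D\<^sup>T * X) * V) $$ (i, j) =
      singval X (Suc i) * (U\<^sup>T * D * V) $$ (i, j) + singval X (Suc j) * (U\<^sup>T * D * V) $$ (j, i)"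
proof -
  have U: "orthogonal_matrix m U" and V: "orthogonal_matrix n V"
    and S: "S = mat m n (\<lambda>(i, j). if i = j then singval X (i + 1) else 0)" and XS: "X = U * S * V\<^sup>T"
    using svd by (auto simp: full_svd_def)
  note Ud = orthogonal_matrixD[OF U] and Vd = orthogonal_matrixD[OF V]
  have Sc: "S \<in> carrier_mat m n" by (simp add: S)
  define E where "E = X * V"
  have Ec: "E \<in> carrier_mat m n" using X Vd by (simp add: E_def)
  have EU: "E = U * S"
  proof -
    have "E = U * S * (V\<^sup>T * V)"
      unfolding E_def using Ud(1) Vd(1) Sc by (subst XS) (rule assoc_mult_mat[of _ m n _ n _ n], auto)
    then show ?thesis using Vd Ud Sc by simp
  qed
  have ST: "(S\<^sup>T * Z) $$ (i, j) = singval X (Suc i) * Z $$ (i, j)"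
    if Z: "Z \<in> carrier_mat m n" and ij: "i < n" "j < n" for Z i j
  proof -
    have "(S\<^sup>T * Z) $$ (i, j) = (\<Sum>a<m. S\<^sup>T $$ (i, a) * Z $$ (a, j))"
      using Sc Z ij by (intro index_mult_mat_sum[of _ n m _ n]) auto
    also have "\<dots> = (\<Sum>a<m. if a = i then singval X (Suc i) * Z $$ (a, j) else 0)"
      using ij nm by (intro sum.cong) (auto simp: S)
    finally show ?thesis using ij nm by simp
  qed
  have "V\<^sup>T * (X\<^sup>T * X) * V = E\<^sup>T * E"
    unfolding E_def by (rule gram_congruence[OF X Vd(1)])
  also have "\<dots> = S\<^sup>T * ((U\<^sup>T * U) * S)"
    unfolding EU using Ud(1) Sc by (simp add: transpose_mult[of _ m m]
        assoc_mult_mat[of _ n m _ m _ n] assoc_mult_mat[of _ m m _ m _ n])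
  also have "\<dots> = S\<^sup>T * S" using Ud Sc by simp
  also have "\<dots> = mat_diag n (\<lambda>i. eigvals_desc (X\<^sup>T * X) ! i)"
  proof (rule eq_matI)
    fix i j assume "i < dim_row (mat_diag n (\<lambda>i. eigvals_desc (X\<^sup>T * X) ! i))"
      "j < dim_col (mat_diag n (\<lambda>i. eigvals_desc (X\<^sup>T * X) ! i))"
    then have ij: "i < n" "j < n" by (auto simp: mat_diag_def)
    then show "(S\<^sup>T * S) $$ (i, j) = mat_diag n (\<lambda>i. eigvals_desc (X\<^sup>T * X) ! i) $$ (i, j)"
      using ST[OF Sc ij] nm singval_square(1)[OF X ij(1)]
      by (auto simp: S mat_diag_def power2_eq_square simp del: index_mult_mat)
  qed (use Sc in \<open>auto simp: mat_diag_def\<close>)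
  finally show "V\<^sup>T * (X\<^sup>T * X) * V = mat_diag n (\<lambda>i. eigvals_desc (X\<^sup>T * X) ! i)" .
  fix i j assume ij: "i < n" "j < n"
  define F where "F = E\<^sup>T * (D * V)"
  have F: "F \<in> carrier_mat n n" using Ec D Vd by (simp add: F_def)
  have Fij: "F $$ (i, j) = singval X (Suc i) * (U\<^sup>T * D * V) $$ (i, j)" if ij: "i < n" "j < n" for i j
  proof -
    have "F = S\<^sup>T * (U\<^sup>T * D * V)"
      unfolding F_def EU using Ud(1) Vd(1) D Sc by (simp add: transpose_mult[of _ m m]
        assoc_mult_mat[of _ n m _ m _ n] assoc_mult_mat[of _ m m _ n _ n])
    then show ?thesis using ST[of "U\<^sup>T * D * V"] ij Ud(1) Vd(1) D nm by simp
  qed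
  have "V\<^sup>T * (X\<^sup>T * D + D\<^sup>T * X) * V = F + F\<^sup>T"
    unfolding F_def E_def by (rule gram_first_order_congruence[OF X D Vd(1)])
  then show "(V\<^sup>T * (X\<^sup>T * D + D\<^sup>T * X) * V) $$ (i, j) =
      singval X (Suc i) * (U\<^sup>T * D * V) $$ (i, j) + singval X (Suc j) * (U\<^sup>T * D * V) $$ (j, i)"
    using F ij Fij[OF ij] Fij[OF ij(2) ij(1)] by simp
qed

lemma pick_lessThan_window: "j < hi - lo \<Longrightarrow> pick {lo..<hi} j = lo + j"
proof -
  assume j: "j < hi - lo"
  have "{a \<in> {lo..<hi}. a < lo + j} = {lo..<lo + j}" using j by auto
  then have "card {a \<in> {lo..<hi}. a < lo + j} = j" by simp
  then show ?thesis using pick_card_in_set[of "lo + j" "{lo..<hi}"] j by simp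
qed

lemma cols_from_to_window:
  assumes A: "A \<in> carrier_mat m n" and le: "r + q \<le> n"
  shows "cols_from_to A (r + 1) (r + q) \<in> carrier_mat m q"
    and "\<And>i j. i < m \<Longrightarrow> j < q \<Longrightarrow> cols_from_to A (r + 1) (r + q) $$ (i, j) = A $$ (i, r + j)"
proof -
  have c: "card {j. j < n \<and> j \<in> {r..<r + q}} = q"
  proof -
    have "{j. j < n \<and> j \<in> {r..<r + q}} = {r..<r + q}" using le by auto
    then show ?thesis by simp
  qed
  show "cols_from_to A (r + 1) (r + q) \<in> carrier_mat m q"
    using A c by (intro carrier_matI) (auto simp: cols_from_to_def dim_submatrix)
  show "cols_from_to A (r + 1) (r + q) $$ (i, j) = A $$ (i, r + j)" if "i < m" "j < q" for i j
    using A c that unfolding cols_from_to_def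
    by (subst submatrix_index) (auto simp: pick_UNIV pick_lessThan_window)
qed

lemma leading_block_index:
  assumes A: "A \<in> carrier_mat m n" and le: "r \<le> m" "r \<le> n"
  shows "leading_block A r \<in> carrier_mat r r"
    and "\<And>i j. i < r \<Longrightarrow> j < r \<Longrightarrow> leading_block A r $$ (i, j) = A $$ (i, j)"
proof -
  have c: "card {j. j < N \<and> j \<in> {..<r}} = r" if "r \<le> N" for N
  proof -
    have "{j. j < N \<and> j \<in> {..<r}} = {..<r}" using that by auto
    then show ?thesis by simp
  qed
  have w: "pick {..<r} i = i" if "i < r" for i
    using pick_lessThan_window[of i r 0] that by (simp add: atLeast0LessThan)
  show "leading_block A r \<in> carrier_mat r r"
    using A c le by (intro carrier_matI) (auto simp: leading_block_def dim_submatrix)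
  show "leading_block A r $$ (i, j) = A $$ (i, j)" if "i < r" "j < r" for i j
    using A c[OF le(1)] c[OF le(2)] that w unfolding leading_block_def
    by (subst submatrix_index) auto
qed

lemma inner_mat_outer_product:
  assumes U: "U \<in> carrier_mat m M" and V: "V \<in> carrier_mat n N" and D: "D \<in> carrier_mat m n"
    and r: "r \<le> M" "r \<le> N"
    and U1: "U1 \<in> carrier_mat m r" "\<And>i j. i < m \<Longrightarrow> j < r \<Longrightarrow> U1 $$ (i, j) = U $$ (i, j)"
    and V1: "V1 \<in> carrier_mat n r" "\<And>i j. i < n \<Longrightarrow> j < r \<Longrightarrow> V1 $$ (i, j) = V $$ (i, j)"
  shows "inner_mat (U1 * mat_diag r d * V1\<^sup>T) D = (\<Sum>i<r. d i * (U\<^sup>T * D * V) $$ (i, i))"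
proof -
  define Z where "Z = U1 * mat_diag r d * V1\<^sup>T"
  have Z: "Z \<in> carrier_mat m n" unfolding Z_def using U1(1) V1(1)
    by (intro mult_carrier_mat[of _ m r] mult_carrier_mat[of U1 m r _ r]) auto
  have UE: "U1 * mat_diag r d = mat m r (\<lambda>(a, i). U1 $$ (a, i) * d i)"
    using U1(1) by (rule mat_diag_mult_right)
  have Zac: "Z $$ (a, c) = (\<Sum>i<r. U $$ (a, i) * d i * V $$ (c, i))" if "a < m" "c < n" for a c
    unfolding Z_def UE using that V1 U1(2)
    by (subst index_mult_mat_sum[of _ m r _ n]) (auto intro!: sum.cong)
  have "inner_mat Z D = (\<Sum>c<n. (Z\<^sup>T * D) $$ (c, c))"
    using Z D by (simp add: inner_mat_def trace_mat_def del: index_mult_mat(1))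
  also have "\<dots> = (\<Sum>c<n. \<Sum>a<m. (\<Sum>i<r. U $$ (a, i) * d i * V $$ (c, i)) * D $$ (a, c))"
  proof (intro sum.cong refl)
    fix c assume "c \<in> {..<n}"
    then have c: "c < n" by simp
    have "(Z\<^sup>T * D) $$ (c, c) = (\<Sum>a<m. Z\<^sup>T $$ (c, a) * D $$ (a, c))"
      using Z D c by (intro index_mult_mat_sum[of _ n m _ n]) auto
    also have "\<dots> = (\<Sum>a<m. (\<Sum>i<r. U $$ (a, i) * d i * V $$ (c, i)) * D $$ (a, c))"
    proof (intro sum.cong refl)
      fix a assume "a \<in> {..<m}"
      then have "Z\<^sup>T $$ (c, a) = Z $$ (a, c)" using Z c by (intro index_transpose_mat(1)) auto
      then show "Z\<^sup>T $$ (c, a) * D $$ (a, c) = (\<Sum>i<r. U $$ (a, i) * d i * V $$ (c, i)) * D $$ (a, c)"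
        using Zac[of a c] c \<open>a \<in> {..<m}\<close> by simp
    qed
    finally show "(Z\<^sup>T * D) $$ (c, c) = (\<Sum>a<m. (\<Sum>i<r. U $$ (a, i) * d i * V $$ (c, i)) * D $$ (a, c))" .
  qed
  also have "\<dots> = (\<Sum>a<m. \<Sum>c<n. \<Sum>i<r. d i * (U $$ (a, i) * D $$ (a, c) * V $$ (c, i)))"
    by (subst sum.swap) (simp add: sum_distrib_left sum_distrib_right mult_ac)
  also have "\<dots> = (\<Sum>a<m. \<Sum>i<r. \<Sum>c<n. d i * (U $$ (a, i) * D $$ (a, c) * V $$ (c, i)))"
    by (intro sum.cong refl sum.swap)
  also have "\<dots> = (\<Sum>i<r. \<Sum>a<m. \<Sum>c<n. d i * (U $$ (a, i) * D $$ (a, c) * V $$ (c, i)))"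
    by (rule sum.swap)
  also have "\<dots> = (\<Sum>i<r. d i * (U\<^sup>T * D * V) $$ (i, i))"
    using r by (intro sum.cong refl) (simp add: index_congruence[OF U D V] sum_distrib_left del: index_mult_mat)
  finally show ?thesis by (simp add: Z_def)
qed

section \<open>The derivative in terms of a singular value decomposition\<close>

lemma sum_lessThan_add_split:
  fixes h :: "nat \<Rightarrow> real"
  shows "(\<Sum>i<r + t. h i) = (\<Sum>i<r. h i) + (\<Sum>j<t. h (r + j))"
  by (induction t) auto

text \<open>The derivative is known in terms of an adapted eigenbasis \<open>V'\<close> and the numbers \<open>b i\<close>; it has to be rewritten
in terms of the given decomposition. The indices below \<open>r = k - t\<close> form complete blocks of equal singular
values, so their contribution is a weighted trace and may be evaluated in the basis \<open>V\<close>. The block of the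
\<open>k\<close>-th singular value is cut after \<open>t\<close> of its \<open>q = t + s\<close> members; there the first-order term of the Gram
matrix is \<open>2 * singval X k\<close> times \<open>M\<close>, so the numbers \<open>b i\<close> of the block are the eigenvalues of \<open>M\<close> up to
this factor, in the same order.\<close>

lemma ky_fan_gateaux_svd:
  fixes X D :: "real mat"
  assumes X: "X \<in> carrier_mat m n" and D: "D \<in> carrier_mat m n" and nm: "n \<le> m"
    and k: "1 \<le> k" "k \<le> n" and p: "1 < p" and X0: "X \<noteq> 0\<^sub>m m n"
    and t: "1 \<le> t" "t \<le> k"
    and grp: "{k - t + 1..k + s} = {j \<in> {1..n}. singval X j = singval X k}"
    and svd: "full_svd m n X U S V"
  defines "U1 \<equiv> cols_from_to U 1 (k - t)" and "U2 \<equiv> cols_from_to U (k - t + 1) (k + s)"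
    and "V1 \<equiv> cols_from_to V 1 (k - t)" and "V2 \<equiv> cols_from_to V (k - t + 1) (k + s)"
  defines "M \<equiv> sym_part (U2\<^sup>T * D * V2)"
  shows "has_gateaux_derivative (ky_fan_norm k p) X D (1 / ky_fan_norm k p X powr (p - 1) *
    (inner_mat (U1 * diag_powr (leading_block S (k - t)) (p - 1) * V1\<^sup>T) D +
      singval X k powr (p - 1) * (\<Sum>l=1..t. eigval M l)))"
proof -
  define l where "l = (!) (eigvals_desc (X\<^sup>T * X))"
  define \<sigma> where "\<sigma> i = singval X (Suc i)" for i
  define r q where "r = k - t" and "q = t + s"
  define g where "g i j = (U\<^sup>T * D * V) $$ (i, j)" for i j
  let ?B = "X\<^sup>T * D + D\<^sup>T * X"
  have Uo: "orthogonal_matrix m U" and Vo: "orthogonal_matrix n V"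
    and S: "S = mat m n (\<lambda>(i, j). if i = j then singval X (i + 1) else 0)"
    using svd by (auto simp: full_svd_def)
  note Uc = orthogonal_matrixD(1)[OF Uo] and Vc = orthogonal_matrixD(1)[OF Vo]
  note B = gram_first_order_symmetric(1)[OF X D]
  have VH: "V\<^sup>T * (X\<^sup>T * X) * V = mat_diag n l"
    unfolding l_def by (rule full_svd_facts(1)[OF X D nm svd])
  have VB: "(V\<^sup>T * ?B * V) $$ (i, j) = \<sigma> i * g i j + \<sigma> j * g j i" if "i < n" "j < n" for i j
    unfolding \<sigma>_def g_def by (rule full_svd_facts(2)[OF X D nm svd that])
  have sq: "(\<sigma> i)\<^sup>2 = l i" and snn: "\<sigma> i \<ge> 0" if "i < n" for i
    using singval_square[OF X that] by (auto simp: \<sigma>_def l_def)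
  have lanti: "l j \<le> l i" if "i \<le> j" "j < n" for i j
    unfolding l_def using spectral_theorem(3)[OF gram_symmetric[OF X] that] .
  have k1: "k - 1 < n" using k by simp
  have sk: "singval X k = \<sigma> (k - 1)" using k by (simp add: \<sigma>_def)
  have rt: "r + t = k" "r + q = k + s" using t by (auto simp: r_def q_def)
  have mem: "Suc i \<in> {k - t + 1..k + s} \<longleftrightarrow> singval X (Suc i) = singval X k" if "i < n" for i
    unfolding grp using that by auto
  have rq: "r + q \<le> n"
  proof -
    have "k + s \<in> {k - t + 1..k + s}" using t by auto
    then have "k + s \<in> {1..n}" unfolding grp by simp
    then show ?thesis using rt by simp
  qed
  have block: "l i = l (k - 1) \<longleftrightarrow> r \<le> i \<and> i < r + q" if i: "i < n" for i
  proof -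
    have "l i = l (k - 1) \<longleftrightarrow> \<sigma> i = \<sigma> (k - 1)"
      unfolding sq[OF i, symmetric] sq[OF k1, symmetric]
      using snn[OF i] snn[OF k1] by (simp add: power2_eq_iff_nonneg)
    also have "\<dots> \<longleftrightarrow> Suc i \<in> {k - t + 1..k + s}"
      using mem[OF i] by (simp add: sk flip: \<sigma>_def)
    also have "\<dots> \<longleftrightarrow> r \<le> i \<and> i < r + q" using rt by (auto simp: r_def)
    finally show ?thesis .
  qed
  obtain V' b where V': "orthogonal_matrix n V'" "V'\<^sup>T * (X\<^sup>T * X) * V' = mat_diag n l"
    and VB': "\<And>i j. i < n \<Longrightarrow> j < n \<Longrightarrow> l i = l j \<Longrightarrow> (V'\<^sup>T * ?B * V') $$ (i, j) = (if i = j then b i else 0)"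
    and b: "\<And>i j. i \<le> j \<Longrightarrow> j < n \<Longrightarrow> l i = l j \<Longrightarrow> b j \<le> b i"
    and der: "has_gateaux_derivative (ky_fan_norm k p) X D
      (1 / ky_fan_norm k p X powr (p - 1) * (\<Sum>i<k. l i powr (p / 2 - 1) * b i / 2))"
    by (rule ky_fan_gateaux_adapted_basis[OF X D k p X0, folded l_def]) (rule that; assumption)
  have pow: "(\<sigma> i)\<^sup>2 powr (p / 2 - 1) * \<sigma> i = \<sigma> i powr (p - 1)" if "\<sigma> i > 0" for i
  proof -
    have "(\<sigma> i)\<^sup>2 powr (p / 2 - 1) = \<sigma> i powr (p - 2)"
      using that by (simp add: powr_powr algebra_simps flip: powr_numeral)
    moreover have "\<sigma> i powr (p - 1) = \<sigma> i powr (p - 2) * \<sigma> i powr 1"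
      by (simp only: powr_add[symmetric]) simp
    ultimately show ?thesis using that by simp
  qed
  \<comment> \<open>The weight of an eigenvalue in the derivative, cut off so that it selects exactly the indices below \<open>r\<close>.\<close>
  define f where "f x = (if l (k - 1) < x then x powr (p / 2 - 1) / 2 else 0)" for x
  have fl: "f (l i) = (if i < r then l i powr (p / 2 - 1) / 2 else 0)" if i: "i < n" for i
  proof (cases "i < r")
    case True
    then have "l (k - 1) \<le> l i" using lanti[of i "k - 1"] k rt by simp
    moreover have "l i \<noteq> l (k - 1)" using block[OF i] True by simp
    ultimately show ?thesis using True by (simp add: f_def)
  next
    case False
    have "l i \<le> l (k - 1)"
    proof (cases "i < r + q")
      case True
      then show ?thesis using False block[OF i] by simp
    next
      case False
      then show ?thesis using lanti[of "k - 1" i] i rt by simp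
    qed
    then show ?thesis using False by (simp add: f_def)
  qed
  have fsum: "(\<Sum>i<n. f (l i) * x i) = (\<Sum>i<r. l i powr (p / 2 - 1) / 2 * x i)" for x
  proof -
    have "(\<Sum>i<n. f (l i) * x i) = (\<Sum>i<r. f (l i) * x i)"
      using rq fl by (intro sum.mono_neutral_right) auto
    then show ?thesis using fl rq by simp
  qed
  have top: "(\<Sum>i<r. l i powr (p / 2 - 1) * b i / 2) = (\<Sum>i<r. \<sigma> i powr (p - 1) * g i i)"
  proof -
    have "(\<Sum>i<r. l i powr (p / 2 - 1) * b i / 2) = (\<Sum>i<n. f (l i) * b i)"
      unfolding fsum by simp
    also have "\<dots> = (\<Sum>i<n. f (l i) * (V'\<^sup>T * ?B * V') $$ (i, i))"
      by (intro sum.cong refl) (simp add: VB' del: index_mult_mat)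
    also have "\<dots> = (\<Sum>i<n. f (l i) * (V\<^sup>T * ?B * V) $$ (i, i))"
      by (rule weighted_trace_basis_independent[OF gram_symmetric(1)[OF X] B Vo VH V'])
    also have "\<dots> = (\<Sum>i<r. l i powr (p / 2 - 1) / 2 * (V\<^sup>T * ?B * V) $$ (i, i))"
      by (rule fsum)
    also have "\<dots> = (\<Sum>i<r. \<sigma> i powr (p - 1) * g i i)"
    proof (intro sum.cong refl)
      fix i assume "i \<in> {..<r}"
      then have i: "i < r" "i < n" using rq by auto
      have "l i \<noteq> l (k - 1)" "l (k - 1) \<le> l i" using block[OF i(2)] lanti[OF _ k1, of i] i rt by auto
      moreover have "0 \<le> l (k - 1)" using sq[OF k1] by (metis zero_le_power2)
      ultimately have "\<sigma> i \<noteq> 0" using sq[OF i(2)] by auto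
      then have "\<sigma> i > 0" using snn[OF i(2)] by simp
      then show "l i powr (p / 2 - 1) / 2 * (V\<^sup>T * ?B * V) $$ (i, i) = \<sigma> i powr (p - 1) * g i i"
        using VB[OF i(2,2)] sq[OF i(2)] pow[of i, symmetric] by (simp del: index_mult_mat)
    qed
    finally show ?thesis .
  qed
  have U1: "U1 \<in> carrier_mat m r" "\<And>i j. i < m \<Longrightarrow> j < r \<Longrightarrow> U1 $$ (i, j) = U $$ (i, j)"
    using cols_from_to_window[OF Uc, of 0 r] rq nm by (auto simp: U1_def r_def)
  have V1: "V1 \<in> carrier_mat n r" "\<And>i j. i < n \<Longrightarrow> j < r \<Longrightarrow> V1 $$ (i, j) = V $$ (i, j)"
    using cols_from_to_window[OF Vc, of 0 r] rq by (auto simp: V1_def r_def)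
  have U2: "U2 \<in> carrier_mat m q" "\<And>i j. i < m \<Longrightarrow> j < q \<Longrightarrow> U2 $$ (i, j) = U $$ (i, r + j)"
    using cols_from_to_window[OF Uc, of r q] rq nm rt by (auto simp: U2_def r_def)
  have V2: "V2 \<in> carrier_mat n q" "\<And>i j. i < n \<Longrightarrow> j < q \<Longrightarrow> V2 $$ (i, j) = V $$ (i, r + j)"
    using cols_from_to_window[OF Vc, of r q] rq rt by (auto simp: V2_def r_def)
  have Sc: "S \<in> carrier_mat m n" by (simp add: S)
  have "diag_powr (leading_block S r) (p - 1) = mat_diag r (\<lambda>i. \<sigma> i powr (p - 1))"
    using leading_block_index[OF Sc, of r] rq nm
    by (intro eq_matI) (auto simp: diag_powr_def mat_diag_def S \<sigma>_def)
  then have inner: "inner_mat (U1 * diag_powr (leading_block S (k - t)) (p - 1) * V1\<^sup>T) D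
      = (\<Sum>i<r. \<sigma> i powr (p - 1) * g i i)"
    using inner_mat_outer_product[OF Uc Vc D _ _ U1 V1] rq nm by (simp add: g_def r_def)
  have low: "(\<Sum>j<t. l (r + j) powr (p / 2 - 1) * b (r + j) / 2)
      = singval X k powr (p - 1) * (\<Sum>l=1..t. eigval M l)"
  proof (cases "\<sigma> (k - 1) = 0")
    case True
    \<comment> \<open>Both weights vanish, as \<open>0 powr _ = 0\<close>.\<close>
    then have "l (k - 1) = 0" using sq[of "k - 1"] k by simp
    then have "l (r + j) = 0" if "j < t" for j
      using block[of "r + j"] that rq by (simp add: q_def)
    then show ?thesis using True by (simp add: sk)
  next
    case False
    define c where "c = 1 / (2 * \<sigma> (k - 1))"
    have pos: "\<sigma> (k - 1) > 0" using False snn[OF k1] by simp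
    have G: "(U2\<^sup>T * D * V2) $$ (i, j) = g (r + i) (r + j)" if ij: "i < q" "j < q" for i j
      unfolding g_def index_congruence[OF U2(1) D V2(1) ij]
      using ij rq nm by (subst index_congruence[OF Uc D Vc]) (auto simp: U2 V2 intro!: sum.cong)
    have Gc: "U2\<^sup>T * D * V2 \<in> carrier_mat q q" using U2(1) V2(1) D
      by (intro mult_carrier_mat[of _ q n _ q] mult_carrier_mat[of _ q m _ n]) auto
    have Mc: "M \<in> carrier_mat q q" using Gc by (simp add: M_def sym_part_def)
    have Mij: "M $$ (i, j) = c * (V\<^sup>T * ?B * V) $$ (r + i, r + j)" if ij: "i < q" "j < q" for i j
    proof -
      have rij: "r + i < n" "r + j < n" using ij rq by auto
      have "\<sigma> (r + i) = \<sigma> (k - 1)" if "i < q" for i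
      proof -
        have "Suc (r + i) \<in> {k - t + 1..k + s}" using that rt by (simp flip: r_def)
        then have "singval X (Suc (r + i)) = singval X k" unfolding grp by simp
        then show ?thesis by (simp add: \<sigma>_def[symmetric] sk)
      qed
      then have "(V\<^sup>T * ?B * V) $$ (r + i, r + j) = \<sigma> (k - 1) * (g (r + i) (r + j) + g (r + j) (r + i))"
        using VB[OF rij] ij by (simp add: distrib_left)
      moreover have "M $$ (i, j) = (g (r + i) (r + j) + g (r + j) (r + i)) / 2"
        using G[OF ij] G[OF ij(2) ij(1)] Gc ij by (simp add: M_def sym_part_def del: index_mult_mat)
      ultimately show ?thesis using pos by (simp add: c_def)
    qed
    have ev: "eigvals_desc M = map (\<lambda>i. c * b (r + i)) [0..<q]"
      by (rule block_eigvals[OF gram_symmetric(1)[OF X] B Vo VH V' VB' b rq block Mc _ Mij])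
        (use pos in \<open>auto simp: c_def\<close>)
    have "(\<Sum>l=1..t. eigval M l) = (\<Sum>j<t. c * b (r + j))"
      by (simp add: sum.atLeast1_atMost_eq eigval_def ev q_def)
    then have "singval X k powr (p - 1) * (\<Sum>l=1..t. eigval M l) = (\<Sum>j<t. \<sigma> (k - 1) powr (p - 1) * (c * b (r + j)))"
      by (simp add: sk sum_distrib_left)
    also have "\<dots> = (\<Sum>j<t. l (r + j) powr (p / 2 - 1) * b (r + j) / 2)"
    proof (intro sum.cong refl)
      fix j assume "j \<in> {..<t}"
      then have "l (r + j) = (\<sigma> (k - 1))\<^sup>2"
        using block[of "r + j"] rq k sq[of "k - 1"] by (simp add: q_def)
      then show "\<sigma> (k - 1) powr (p - 1) * (c * b (r + j)) = l (r + j) powr (p / 2 - 1) * b (r + j) / 2"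
        unfolding pow[OF pos, symmetric] using pos by (simp add: c_def)
    qed
    finally show ?thesis by simp
  qed
  have "(\<Sum>i<k. l i powr (p / 2 - 1) * b i / 2)
      = inner_mat (U1 * diag_powr (leading_block S (k - t)) (p - 1) * V1\<^sup>T) D +
      singval X k powr (p - 1) * (\<Sum>l=1..t. eigval M l)"
    using sum_lessThan_add_split[of "\<lambda>i. l i powr (p / 2 - 1) * b i / 2" r t]
    unfolding rt top low inner .
  then show ?thesis using der by simp
qed

theorem proposition5p8:
  fixes m n k :: nat and p :: real and A :: "dual_number mat" and As Ai :: "real mat"
  assumes "n \<le> m" and "1 \<le> k" and "k \<le> n" and "1 < p"
    and "A \<in> carrier_mat m n"
    and "As = std_mat A" and "Ai = inf_mat A"
  shows "(\<exists>L. has_gateaux_derivative (ky_fan_norm k p) As Ai L) \<and>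
    (As = 0\<^sub>m m n \<longrightarrow>
       dual_continuation (ky_fan_norm k p) A = of_real (ky_fan_norm k p Ai) * eps) \<and>
    (As \<noteq> 0\<^sub>m m n \<longrightarrow>
      (\<forall>(t::nat) (s::nat) U S V.
         1 \<le> t \<and> t \<le> k \<and>
         {k - t + 1..k + s} = {j \<in> {1..n}. singval As j = singval As k} \<and>
         full_svd m n As U S V \<longrightarrow>
         (let U1 = cols_from_to U 1 (k - t);
              U2 = cols_from_to U (k - t + 1) (k + s);
              V1 = cols_from_to V 1 (k - t);
              V2 = cols_from_to V (k - t + 1) (k + s);
              S1 = leading_block S (k - t);
              M = sym_part (U2\<^sup>T * Ai * V2)
          in dual_continuation (ky_fan_norm k p) A =
               of_real (ky_fan_norm k p As) +
               of_real (1 / ky_fan_norm k p As powr (p - 1) *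
                 (inner_mat (U1 * diag_powr S1 (p - 1) * V1\<^sup>T) Ai +
                  singval As k powr (p - 1) * (\<Sum>l=1..t. eigval M l))) * eps)))"
proof -
  have As: "As \<in> carrier_mat m n" and Ai: "Ai \<in> carrier_mat m n"
    using assms(5-7) by (auto simp: std_mat_def inf_mat_def)
  have dual: "dual_continuation (ky_fan_norm k p) A = of_real (ky_fan_norm k p As) + of_real L * eps"
    if "has_gateaux_derivative (ky_fan_norm k p) As Ai L" for L
    using has_gateaux_derivative_unique[OF that] assms(6,7) by (simp add: dual_continuation_def)
  have "\<exists>L. has_gateaux_derivative (ky_fan_norm k p) As Ai L"
  proof (cases "As = 0\<^sub>m m n")
    case True
    then show ?thesis using ky_fan_gateaux_derivative_zero(2)[OF Ai assms(3,4)] by blast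
  next
    case False
    then show ?thesis by (rule ky_fan_gateaux_adapted_basis[OF As Ai assms(2-4)]) blast
  qed
  moreover have "dual_continuation (ky_fan_norm k p) A = of_real (ky_fan_norm k p Ai) * eps"
    if "As = 0\<^sub>m m n"
    using dual[of "ky_fan_norm k p Ai"] ky_fan_gateaux_derivative_zero[OF Ai assms(3,4)] that by simp
  moreover have "dual_continuation (ky_fan_norm k p) A =
      of_real (ky_fan_norm k p As) +
      of_real (1 / ky_fan_norm k p As powr (p - 1) *
        (inner_mat (cols_from_to U 1 (k - t) * diag_powr (leading_block S (k - t)) (p - 1) *
            (cols_from_to V 1 (k - t))\<^sup>T) Ai +
          singval As k powr (p - 1) * (\<Sum>l=1..t. eigval (sym_part
            ((cols_from_to U (k - t + 1) (k + s))\<^sup>T * Ai * cols_from_to V (k - t + 1) (k + s))) l))) * eps"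
    if "As \<noteq> 0\<^sub>m m n" "1 \<le> t" "t \<le> k"
      "{k - t + 1..k + s} = {j \<in> {1..n}. singval As j = singval As k}" "full_svd m n As U S V"
    for t s U S V
    by (rule dual, rule ky_fan_gateaux_svd[OF As Ai assms(1-4) that])
  ultimately show ?thesis unfolding Let_def by blast
qed

end
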